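(* Let $n\ge2$, and suppose the family $(g_\lambda)_{\lambda>0}$ satisfies $(A_1)$: $\sup_{x\in[0,\kappa]}|xg_\lambda(x)|\le C_1$ and $(A_2)$: $\sup_{x\in[0,\kappa]}|\lambda g_\lambda(x)|\le C_2$. Let $X_1,\dots,X_n$ be i.i.d. from $P_0$. Then for any $\alpha>0$ and any $\lambda>0$, $$P_{H_0}\{\hat\eta_\lambda\ge\gamma\}\le\alpha,\qquad\text{where }\gamma=\frac{2(C_1+C_2)\,\mathcal N_2(\lambda)}{n\sqrt\alpha}.$$
   Context: Setting. $(\mathcal X,\mathcal B)$ is a second countable space with its Borel $\sigma$-algebra; $\mathscr H$ is an RKHS of real functions on $\mathcal X$ with continuous reproducing kernel $K$, $\sup_xK(x,x)\le\kappa$. $P_0$ is a fixed probability measure on $\mathcal X$ and $\mu_0=\int K(\cdot,x)\,dP_0(x)\in\mathscr H$. Covariance operator. $\Sigma_0=\int(K(\cdot,x)-\mu_0)\otimes_{\mathscr H}(K(\cdot,x)-\mu_0)\,dP_0(x)$, $\Sigma_{0,\lambda}=\Sigma_0+\lambda I$, and $\mathcal N_2(\lambda)=\|\Sigma_{0,\lambda}^{-1/2}\Sigma_0\Sigma_{0,\lambda}^{-1/2}\|_{\mathcal L^2(\mathscr H)}$ (Hilbert–Schmidt norm). Regularizer. For each $\lambda>0$, $g_\lambda$ is a positive function on $[0,\infty)$; $C_1,C_2$ are finite positive constants independent of $\lambda$. For a compact self-adjoint positive operator $\mathcal B=\sum_i\tau_i\psi_i\otimes\psi_i$, $g_\lambda(\mathcal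 B)=\sum_ig_\lambda(\tau_i)\psi_i\otimes\psi_i+g_\lambda(0)(I-\sum_i\psi_i\otimes\psi_i)$; $g_\lambda^{1/2}(\mathcal B)$ is its square root. Statistic. $\hat\eta_\lambda=\frac1{n(n-1)}\sum_{i\ne j}\big\langle g_\lambda^{1/2}(\Sigma_0)(K(\cdot,X_i)-\mu_0),\,g_\lambda^{1/2}(\Sigma_0)(K(\cdot,X_j)-\mu_0)\big\rangle_{\mathscr H}$. $P_{H_0}$ is probability when the $X_i$ are i.i.d. from $P_0$.
   Formalization: The formal theorem additionally assumes that the covariance operator Σ₀ is not zero; if Σ₀ = 0 (e.g. P₀ a Dirac mass) then the statistic and γ both vanish, so the probability is 1 and the claim fails for α < 1. *)

theory Defs
  imports "HOL-Probability.Probability"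
begin

text \<open>
  The elements of the Hilbert space \<open>'h\<close> are identified with real functions on \<open>'x\<close> through the
  injective linear evaluation map \<open>evl\<close>; \<open>inv evl (\<lambda>y. K y x)\<close> is the element \<open>K(\<cdot>,x)\<close>.
\<close>

locale rkhs =
  fixes evl :: "'h::{real_inner, banach} \<Rightarrow> 'x \<Rightarrow> real"
    and K :: "'x \<Rightarrow> 'x \<Rightarrow> real"
  assumes evl_add: "evl (f + g) x = evl f x + evl g x"
    and evl_scaleR: "evl (c *\<^sub>R f) x = c * evl f x"
    and inj_evl: "inj evl"
    and kernel_mem: "(\<lambda>y. K y x) \<in> range evl"
    and reproducing: "evl f x = f \<bullet> inv evl (\<lambda>y. K y x)"

definition kernel_section :: "('h \<Rightarrow> 'x \<Rightarrow> real) \<Rightarrow> ('x \<Rightarrow> 'x \<Rightarrow> real) \<Rightarrow> 'x \<Rightarrow> 'h" where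
  "kernel_section evl K x = inv evl (\<lambda>y. K y x)"

text \<open>
  Separability of \<open>'h\<close> is what the Bochner integral of the library asks for. It is automatic for an
  RKHS with continuous kernel on a second countable space: \<open>x \<mapsto> K(\<cdot>,x)\<close> is then continuous and
  the span of its range is dense.
\<close>

definition mean_element ::
  "('h::{real_inner, banach, second_countable_topology} \<Rightarrow> 'x \<Rightarrow> real) \<Rightarrow> ('x \<Rightarrow> 'x \<Rightarrow> real)
    \<Rightarrow> 'x measure \<Rightarrow> 'h" where
  "mean_element evl K P = (\<integral>x. kernel_section evl K x \<partial>P)"

definition centered_section ::
  "('h::{real_inner, banach, second_countable_topology} \<Rightarrow> 'x \<Rightarrow> real) \<Rightarrow> ('x \<Rightarrow> 'x \<Rightarrow> real)
    \<Rightarrow> 'x measure \<Rightarrow> 'x \<Rightarrow> 'h" where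
  "centered_section evl K P x = kernel_section evl K x - mean_element evl K P"

definition tensor_op :: "'h::real_inner \<Rightarrow> 'h \<Rightarrow> 'h \<Rightarrow> 'h" where
  "tensor_op a b f = (b \<bullet> f) *\<^sub>R a"

text \<open>
  The operator-valued integral is taken in the strong sense, i.e. applied to each \<open>f\<close>; this agrees
  with the Bochner integral in the space of Hilbert-Schmidt operators.
\<close>

definition cov_op ::
  "('h::{real_inner, banach, second_countable_topology} \<Rightarrow> 'x \<Rightarrow> real) \<Rightarrow> ('x \<Rightarrow> 'x \<Rightarrow> real)
    \<Rightarrow> 'x measure \<Rightarrow> 'h \<Rightarrow> 'h" where
  "cov_op evl K P f =
    (\<integral>x. tensor_op (centered_section evl K P x) (centered_section evl K P x) f \<partial>P)"

definition positive_op :: "('h::real_inner \<Rightarrow> 'h) \<Rightarrow> bool" where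
  "positive_op A \<longleftrightarrow>
    bounded_linear A \<and> (\<forall>f h. A f \<bullet> h = f \<bullet> A h) \<and> (\<forall>f. 0 \<le> A f \<bullet> f)"

definition op_sqrt :: "('h::real_inner \<Rightarrow> 'h) \<Rightarrow> 'h \<Rightarrow> 'h" where
  "op_sqrt A = (THE S. positive_op S \<and> S \<circ> S = A)"

definition is_onb :: "'h::real_inner set \<Rightarrow> bool" where
  "is_onb E \<longleftrightarrow> (\<forall>e\<in>E. norm e = 1) \<and> pairwise orthogonal E \<and> closure (span E) = UNIV"

text \<open>For a Hilbert-Schmidt operator the value does not depend on the chosen basis.\<close>

definition hs_norm :: "('h::real_inner \<Rightarrow> 'h) \<Rightarrow> real" where
  "hs_norm A = sqrt (\<Sum>\<^sub>\<infinity>e\<in>(SOME E. is_onb E). (norm (A e))\<^sup>2)"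

text \<open>
  \<open>B = (\<Sum>i\<in>I. \<tau> i \<psi> i \<otimes> \<psi> i)\<close> with orthonormal \<open>\<psi>\<close>. Orthonormal families in a separable space are
  countable, so \<open>I\<close> is taken to be a set of natural numbers. Zero eigenvalues may be listed or not.
\<close>

definition spectral_decomp ::
  "('h::real_inner \<Rightarrow> 'h) \<Rightarrow> nat set \<Rightarrow> (nat \<Rightarrow> real) \<Rightarrow> (nat \<Rightarrow> 'h) \<Rightarrow> bool" where
  "spectral_decomp B I \<tau> \<psi> \<longleftrightarrow>
    (\<forall>i\<in>I. \<forall>j\<in>I. \<psi> i \<bullet> \<psi> j = (if i = j then 1 else 0)) \<and>
    (\<forall>i\<in>I. 0 \<le> \<tau> i) \<and>
    (\<forall>f. ((\<lambda>i. \<tau> i *\<^sub>R tensor_op (\<psi> i) (\<psi> i) f) has_sum B f) I)"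

text \<open>
  For \<open>g\<close> bounded on the spectrum the choice of decomposition is immaterial; one exists for every compact
  self-adjoint positive \<open>B\<close> on a separable Hilbert space.
\<close>

definition fun_calc :: "(real \<Rightarrow> real) \<Rightarrow> ('h::real_inner \<Rightarrow> 'h) \<Rightarrow> 'h \<Rightarrow> 'h" where
  "fun_calc g B =
    (case (SOME (I, \<tau>, \<psi>). spectral_decomp B I \<tau> \<psi>) of (I, \<tau>, \<psi>) \<Rightarrow>
      (\<lambda>f. (\<Sum>\<^sub>\<infinity>i\<in>I. g (\<tau> i) *\<^sub>R tensor_op (\<psi> i) (\<psi> i) f) +
           g 0 *\<^sub>R (f - (\<Sum>\<^sub>\<infinity>i\<in>I. tensor_op (\<psi> i) (\<psi> i) f))))"

definition N2 ::
  "('h::{real_inner, banach, second_countable_topology} \<Rightarrow> 'x \<Rightarrow> real) \<Rightarrow> ('x \<Rightarrow> 'x \<Rightarrow> real)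
    \<Rightarrow> 'x measure \<Rightarrow> real \<Rightarrow> real" where
  "N2 evl K P l =
    (let R = inv (op_sqrt (\<lambda>f. cov_op evl K P f + l *\<^sub>R f))
     in hs_norm (R \<circ> cov_op evl K P \<circ> R))"

definition eta_hat ::
  "('h::{real_inner, banach, second_countable_topology} \<Rightarrow> 'x \<Rightarrow> real) \<Rightarrow> ('x \<Rightarrow> 'x \<Rightarrow> real)
    \<Rightarrow> 'x measure \<Rightarrow> (real \<Rightarrow> real) \<Rightarrow> nat \<Rightarrow> (nat \<Rightarrow> 'x) \<Rightarrow> real" where
  "eta_hat evl K P g n x =
    (let T = op_sqrt (fun_calc g (cov_op evl K P))
     in 1 / (real n * (real n - 1)) *
        (\<Sum>i\<in>{1..n}. \<Sum>j\<in>{1..n} - {i}.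
           T (centered_section evl K P (x i)) \<bullet> T (centered_section evl K P (x j))))"

end

theory Submission
  imports Defs "HOL-Complex_Analysis.Great_Picard"
begin

text \<open>
  \<open>\<Sigma>\<^sub>0\<close> is positive and compact, so any of its spectral decompositions extends to an orthonormal basis \<open>E\<close>
  of eigenvectors \<open>e\<close> with eigenvalues \<open>t e\<close>. Bounded operators are determined by their values on \<open>E\<close>,
  which evaluates all square roots, inverses and \<open>g\<^sub>\<lambda>(\<Sigma>\<^sub>0)\<close> at once; in particular
  \<open>N\<^sub>2(\<lambda>)\<^sup>2\<close> is the sum of \<open>(t e / (t e + \<lambda>))\<^sup>2\<close>. The statistic is a degenerate U-statistic with kernel
  \<open>h(x, y) = \<langle>g\<^sub>\<lambda>(\<Sigma>\<^sub>0) c(x), c(y)\<rangle>\<close>, \<open>c\<close> the centered feature map. Distinct unordered pairs are uncorrelated,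
  so its second moment is \<open>2 E h\<^sup>2 / (n (n - 1))\<close>, and
  \<open>E h\<^sup>2\<close> is at most the sum of \<open>(t e * g\<^sub>\<lambda>(t e))\<^sup>2 \<le> (C\<^sub>1 + C\<^sub>2)\<^sup>2 (t e / (t e + \<lambda>))\<^sup>2\<close>. Markov's inequality
  for the square then gives the bound \<open>\<alpha> n / (2 (n - 1)) \<le> \<alpha>\<close>.
\<close>

section \<open>Orthonormal families\<close>

text \<open>Indexed families rather than sets: the form serves both the eigenvectors listed by
  natural numbers in \<open>spectral_decomp\<close> and, with the identity as family, the bases of
  \<open>is_onb\<close>.\<close>

definition orthonormal_on :: "('i \<Rightarrow> 'h::real_inner) \<Rightarrow> 'i set \<Rightarrow> bool" where
  "orthonormal_on \<psi> I \<longleftrightarrow> (\<forall>i\<in>I. \<forall>j\<in>I. \<psi> i \<bullet> \<psi> j = (if i = j then 1 else 0))"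

lemma orthonormal_onD:
  "orthonormal_on \<psi> I \<Longrightarrow> i \<in> I \<Longrightarrow> j \<in> I \<Longrightarrow> \<psi> i \<bullet> \<psi> j = (if i = j then 1 else 0)"
  by (simp add: orthonormal_on_def)

lemma orthonormal_on_norm: "orthonormal_on \<psi> I \<Longrightarrow> i \<in> I \<Longrightarrow> norm (\<psi> i) = 1"
  by (simp add: orthonormal_on_def norm_eq_1)

lemma norm_sum_orthonormal:
  assumes "orthonormal_on \<psi> I" "finite F" "F \<subseteq> I"
  shows "(norm (\<Sum>i\<in>F. a i *\<^sub>R \<psi> i))\<^sup>2 = (\<Sum>i\<in>F. (a i)\<^sup>2)"
proof -
  have "(norm (\<Sum>i\<in>F. a i *\<^sub>R \<psi> i))\<^sup>2 = (\<Sum>i\<in>F. \<Sum>j\<in>F. a i * a j * (\<psi> i \<bullet> \<psi> j))"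
    by (simp add: power2_norm_eq_inner inner_sum_left inner_sum_right sum_distrib_left mult_ac
        inner_commute)
  also have "\<dots> = (\<Sum>i\<in>F. \<Sum>j\<in>F. if i = j then (a i)\<^sup>2 else 0)"
    using assms by (intro sum.cong refl) (auto simp: power2_eq_square orthonormal_onD subset_eq)
  also have "\<dots> = (\<Sum>i\<in>F. (a i)\<^sup>2)"
    using assms by simp
  finally show ?thesis .
qed

lemma Bessel_inequality_finite:
  assumes "orthonormal_on \<psi> I" "finite F" "F \<subseteq> I"
  shows "(\<Sum>i\<in>F. (\<psi> i \<bullet> f)\<^sup>2) \<le> (norm f)\<^sup>2"
proof -
  let ?s = "\<Sum>i\<in>F. (\<psi> i \<bullet> f) *\<^sub>R \<psi> i"
  have "0 \<le> (norm (f - ?s))\<^sup>2" by simp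
  also have "\<dots> = (norm f)\<^sup>2 - 2 * (?s \<bullet> f) + (norm ?s)\<^sup>2"
    by (simp add: power2_norm_eq_inner inner_diff_left inner_diff_right inner_commute)
  also have "?s \<bullet> f = (\<Sum>i\<in>F. (\<psi> i \<bullet> f)\<^sup>2)"
    by (simp add: inner_sum_left power2_eq_square)
  also have "(norm ?s)\<^sup>2 = (\<Sum>i\<in>F. (\<psi> i \<bullet> f)\<^sup>2)"
    by (rule norm_sum_orthonormal[OF assms])
  finally show ?thesis by simp
qed

lemma Bessel_summable:
  assumes "orthonormal_on \<psi> I"
  shows "(\<lambda>i. (\<psi> i \<bullet> f)\<^sup>2) summable_on I"
  using Bessel_inequality_finite[OF assms]
  by (intro nonneg_bdd_above_summable_on bdd_aboveI[where M = "(norm f)\<^sup>2"]) auto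

lemma Bessel_inequality:
  assumes "orthonormal_on \<psi> I"
  shows "(\<Sum>\<^sub>\<infinity>i\<in>I. (\<psi> i \<bullet> f)\<^sup>2) \<le> (norm f)\<^sup>2"
  using Bessel_summable[OF assms] Bessel_inequality_finite[OF assms] by (rule infsum_le_finite_sums)

text \<open>Riesz-Fischer. By Pythagoras the distance between nested finite partial sums is the root
  of a piece of the tail of the squares, so the net of partial sums is Cauchy and converges by
  completeness.\<close>

lemma orthonormal_summable:
  fixes \<psi> :: "'i \<Rightarrow> 'h::{real_inner, banach}"
  assumes \<psi>: "orthonormal_on \<psi> I" and sm: "(\<lambda>i. (a i)\<^sup>2) summable_on I"
  shows "(\<lambda>i. a i *\<^sub>R \<psi> i) summable_on I"
proof -
  let ?f = "\<lambda>i. a i *\<^sub>R \<psi> i" and ?L = "\<Sum>\<^sub>\<infinity>i\<in>I. (a i)\<^sup>2"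
  have "\<exists>P. eventually P (finite_subsets_at_top I) \<and>
          (\<forall>F F'. P F \<and> P F' \<longrightarrow> dist (sum ?f F) (sum ?f F') < e)" if e: "e > 0" for e
  proof -
    have "((\<lambda>i. (a i)\<^sup>2) has_sum ?L) I" using sm by simp
    then have "\<forall>\<^sub>F F in finite_subsets_at_top I. ?L - (e/2)\<^sup>2 < (\<Sum>i\<in>F. (a i)\<^sup>2)"
      unfolding has_sum_def by (rule order_tendstoD) (use e in simp)
    \<comment> \<open>\<open>F0\<close> leaves less than \<open>(e/2)\<^sup>2\<close> of the total,
      so every larger finite set lies within \<open>e/2\<close> of it and any two of them within
      \<open>e\<close>.\<close>
    then obtain F0 where F0: "finite F0" "F0 \<subseteq> I" "?L - (e/2)\<^sup>2 < (\<Sum>i\<in>F0. (a i)\<^sup>2)"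
      unfolding eventually_finite_subsets_at_top by blast
    have near: "dist (sum ?f F) (sum ?f F0) < e/2" if F: "finite F" "F0 \<subseteq> F" "F \<subseteq> I" for F
    proof -
      have "(dist (sum ?f F) (sum ?f F0))\<^sup>2 = (norm (sum ?f (F - F0)))\<^sup>2"
        using F by (simp add: dist_norm sum_diff)
      also have "\<dots> = (\<Sum>i\<in>F - F0. (a i)\<^sup>2)"
        using F by (intro norm_sum_orthonormal[OF \<psi>]) auto
      also have "\<dots> = (\<Sum>i\<in>F. (a i)\<^sup>2) - (\<Sum>i\<in>F0. (a i)\<^sup>2)"
        using F by (simp add: sum_diff)
      also have "\<dots> \<le> ?L - (\<Sum>i\<in>F0. (a i)\<^sup>2)"
        using finite_sum_le_infsum[OF sm F(1,3)] by simp
      also have "\<dots> < (e/2)\<^sup>2" using F0 by simp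
      finally show ?thesis
        using e by (intro power_less_imp_less_base[of _ 2 "e/2"]) auto
    qed
    let ?P = "\<lambda>F. finite F \<and> F0 \<subseteq> F \<and> F \<subseteq> I"
    have "eventually ?P (finite_subsets_at_top I)"
      unfolding eventually_finite_subsets_at_top using F0 by blast
    moreover have "dist (sum ?f F) (sum ?f F') < e" if "?P F" "?P F'" for F F'
      using near[of F] near[of F'] that by (meson dist_triangle_half_l)
    ultimately show ?thesis by (intro exI[of _ ?P] conjI) simp_all
  qed
  then have "cauchy_filter (filtermap (sum ?f) (finite_subsets_at_top I))"
    by (simp add: cauchy_filter_metric_filtermap)
  then obtain L' where "(sum ?f \<longlongrightarrow> L') (finite_subsets_at_top I)"
    using complete_UNIV complete_uniform[where S = UNIV] by (force simp add: filterlim_def)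
  then show ?thesis using summable_on_def has_sum_def by blast
qed

lemma orthonormal_has_sum_inner:
  assumes "orthonormal_on \<psi> I" "((\<lambda>i. a i *\<^sub>R \<psi> i) has_sum s) I" "j \<in> I"
  shows "\<psi> j \<bullet> s = a j"
proof -
  have "((\<lambda>i. \<psi> j \<bullet> (a i *\<^sub>R \<psi> i)) has_sum (\<psi> j \<bullet> s)) I"
    using bounded_linear_inner_right assms(2) by (rule has_sum_bounded_linear)
  moreover have "((\<lambda>i. \<psi> j \<bullet> (a i *\<^sub>R \<psi> i)) has_sum a j) I"
    using assms by (intro has_sum_finite_neutralI[where B = "{j}"]) (auto simp: orthonormal_onD)
  ultimately show ?thesis using has_sum_unique by blast
qed

section \<open>Operators that are diagonal in an orthonormal family\<close>

definition diag_op :: "('i \<Rightarrow> 'h::real_inner) \<Rightarrow> 'i set \<Rightarrow> ('i \<Rightarrow> real) \<Rightarrow> 'h \<Rightarrow> 'h" where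
  "diag_op \<psi> I a f = (\<Sum>\<^sub>\<infinity>i\<in>I. (a i * (\<psi> i \<bullet> f)) *\<^sub>R \<psi> i)"

context
  fixes \<psi> :: "'i \<Rightarrow> 'h::{real_inner, banach}" and I :: "'i set" and a :: "'i \<Rightarrow> real" and C :: real
  assumes \<psi>: "orthonormal_on \<psi> I" and bd: "\<And>i. i \<in> I \<Longrightarrow> \<bar>a i\<bar> \<le> C"
begin

lemma diag_coeff_le: "i \<in> I \<Longrightarrow> (a i * (\<psi> i \<bullet> f))\<^sup>2 \<le> C\<^sup>2 * (\<psi> i \<bullet> f)\<^sup>2"
  using power_mono[OF bd[of i], of 2] by (simp add: power_mult_distrib mult_right_mono)

lemma diag_coeff_summable: "(\<lambda>i. (a i * (\<psi> i \<bullet> f))\<^sup>2) summable_on I"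
proof (rule summable_on_comparison_test)
  show "(\<lambda>i. C\<^sup>2 * (\<psi> i \<bullet> f)\<^sup>2) summable_on I"
    using Bessel_summable[OF \<psi>] by (rule summable_on_cmult_right)
qed (use diag_coeff_le in auto)

lemma diag_op_has_sum: "((\<lambda>i. (a i * (\<psi> i \<bullet> f)) *\<^sub>R \<psi> i) has_sum diag_op \<psi> I a f) I"
  unfolding diag_op_def
  by (intro has_sum_infsum orthonormal_summable[OF \<psi>] diag_coeff_summable)

lemma diag_op_inner: "((\<lambda>i. a i * (\<psi> i \<bullet> f) * (\<psi> i \<bullet> h)) has_sum (diag_op \<psi> I a f \<bullet> h)) I"
  using has_sum_bounded_linear[OF bounded_linear_inner_left diag_op_has_sum, of f h] by simp

lemma diag_op_coeff: "i \<in> I \<Longrightarrow> \<psi> i \<bullet> diag_op \<psi> I a f = a i * (\<psi> i \<bullet> f)"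
  using orthonormal_has_sum_inner[OF \<psi> diag_op_has_sum] .

lemma diag_op_orthonormal: "i \<in> I \<Longrightarrow> diag_op \<psi> I a (\<psi> i) = a i *\<^sub>R \<psi> i"
proof -
  assume i: "i \<in> I"
  have "((\<lambda>j. (a j * (\<psi> j \<bullet> \<psi> i)) *\<^sub>R \<psi> j) has_sum a i *\<^sub>R \<psi> i) I"
    using i \<psi> by (intro has_sum_finite_neutralI[where B = "{i}"]) (auto simp: orthonormal_onD)
  then show ?thesis using diag_op_has_sum has_sum_unique by blast
qed

text \<open>The coefficients of the image are known, so Bessel's inequality applies. The absolute
  value covers an empty \<open>I\<close>, for which the bound on \<open>a\<close> leaves the sign of
  \<open>C\<close> open.\<close>

lemma diag_op_norm: "norm (diag_op \<psi> I a f) \<le> \<bar>C\<bar> * norm f"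
proof -
  have "(norm (diag_op \<psi> I a f))\<^sup>2 = diag_op \<psi> I a f \<bullet> diag_op \<psi> I a f"
    by (simp add: power2_norm_eq_inner)
  also have "\<dots> = (\<Sum>\<^sub>\<infinity>i\<in>I. a i * (\<psi> i \<bullet> f) * (\<psi> i \<bullet> diag_op \<psi> I a f))"
    using infsumI[OF diag_op_inner] by simp
  also have "\<dots> = (\<Sum>\<^sub>\<infinity>i\<in>I. (a i * (\<psi> i \<bullet> f))\<^sup>2)"
    by (intro infsum_cong) (simp add: diag_op_coeff power2_eq_square)
  also have "\<dots> \<le> (\<Sum>\<^sub>\<infinity>i\<in>I. C\<^sup>2 * (\<psi> i \<bullet> f)\<^sup>2)"
    using diag_coeff_le
    by (intro infsum_mono diag_coeff_summable summable_on_cmult_right Bessel_summable[OF \<psi>])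
  also have "\<dots> \<le> C\<^sup>2 * (norm f)\<^sup>2"
    using Bessel_inequality[OF \<psi>] by (simp add: infsum_cmult_right' mult_left_mono)
  also have "\<dots> = (\<bar>C\<bar> * norm f)\<^sup>2"
    by (simp add: power_mult_distrib)
  finally show ?thesis by (rule power2_le_imp_le) simp
qed

lemma diag_op_bounded_linear: "bounded_linear (diag_op \<psi> I a)"
proof (rule bounded_linear_intro)
  fix f h r
  have "((\<lambda>i. (a i * (\<psi> i \<bullet> f)) *\<^sub>R \<psi> i + (a i * (\<psi> i \<bullet> h)) *\<^sub>R \<psi> i) has_sum
          (diag_op \<psi> I a f + diag_op \<psi> I a h)) I"
    by (intro has_sum_add diag_op_has_sum)
  then have "((\<lambda>i. (a i * (\<psi> i \<bullet> (f + h))) *\<^sub>R \<psi> i) has_sum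
          (diag_op \<psi> I a f + diag_op \<psi> I a h)) I"
    by (simp add: inner_add_right algebra_simps)
  then show "diag_op \<psi> I a (f + h) = diag_op \<psi> I a f + diag_op \<psi> I a h"
    using diag_op_has_sum has_sum_unique by blast
  have "((\<lambda>i. r *\<^sub>R ((a i * (\<psi> i \<bullet> f)) *\<^sub>R \<psi> i)) has_sum r *\<^sub>R diag_op \<psi> I a f) I"
    using has_sum_bounded_linear[OF bounded_linear_scaleR_right diag_op_has_sum] .
  then have "((\<lambda>i. (a i * (\<psi> i \<bullet> (r *\<^sub>R f))) *\<^sub>R \<psi> i) has_sum r *\<^sub>R diag_op \<psi> I a f) I"
    by (simp add: mult_ac)
  then show "diag_op \<psi> I a (r *\<^sub>R f) = r *\<^sub>R diag_op \<psi> I a f"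
    using diag_op_has_sum has_sum_unique by blast
  show "norm (diag_op \<psi> I a f) \<le> norm f * \<bar>C\<bar>"
    using diag_op_norm by (simp add: mult.commute)
qed

lemma diag_op_self_adjoint: "diag_op \<psi> I a f \<bullet> h = f \<bullet> diag_op \<psi> I a h"
proof -
  have "((\<lambda>i. a i * (\<psi> i \<bullet> f) * (\<psi> i \<bullet> h)) has_sum (diag_op \<psi> I a h \<bullet> f)) I"
    using diag_op_inner[of h f] by (simp add: mult_ac)
  from has_sum_unique[OF diag_op_inner[of f h] this] show ?thesis
    by (simp add: inner_commute)
qed

lemma diag_op_positive: "(\<And>i. i \<in> I \<Longrightarrow> 0 \<le> a i) \<Longrightarrow> positive_op (diag_op \<psi> I a)"
  unfolding positive_op_def
proof (intro conjI allI)
  fix f h assume pos: "\<And>i. i \<in> I \<Longrightarrow> 0 \<le> a i"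
  show "0 \<le> diag_op \<psi> I a f \<bullet> f"
    using diag_op_inner[of f f] by (rule has_sum_nonneg) (use pos in \<open>simp add: mult.assoc\<close>)
  show "diag_op \<psi> I a f \<bullet> h = f \<bullet> diag_op \<psi> I a h"
    by (rule diag_op_self_adjoint)
qed (rule diag_op_bounded_linear)

end

section \<open>Orthonormal bases and the spectral theorem\<close>

lemma is_onb_orthonormal: "is_onb E \<Longrightarrow> orthonormal_on (\<lambda>e. e) E"
  by (auto simp: is_onb_def orthonormal_on_def norm_eq_1 pairwise_def orthogonal_def)

text \<open>The set of agreement is closed and contains the dense span of \<open>E\<close>. All
  later identities between operators are checked on basis vectors through this lemma.\<close>

lemma bounded_linear_eq_on_onb:
  assumes E: "is_onb E" and A: "bounded_linear A" and B: "bounded_linear B"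
    and eq: "\<And>e. e \<in> E \<Longrightarrow> A e = B e"
  shows "A = B"
proof
  fix f
  have "span E \<subseteq> {f. A f = B f}"
    using linear_eq_on_span[OF A[THEN bounded_linear.linear] B[THEN bounded_linear.linear] eq] by blast
  moreover have "closed {f. A f = B f}"
    using A B by (intro closed_Collect_eq) (auto intro: linear_continuous_on)
  ultimately have "closure (span E) \<subseteq> {f. A f = B f}"
    by (rule closure_minimal)
  then show "A f = B f" using E by (auto simp: is_onb_def)
qed

text \<open>The operator with all multipliers equal to one fixes each basis vector, hence is the
  identity; its defining series is the Fourier expansion.\<close>

lemma onb_expansion:
  fixes f :: "'h::{real_inner, banach}"
  assumes E: "is_onb E"
  shows "((\<lambda>e. (e \<bullet> f) *\<^sub>R e) has_sum f) E"
proof -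
  note on = is_onb_orthonormal[OF E]
  have "diag_op (\<lambda>e. e) E (\<lambda>_. 1) = (\<lambda>f. f)"
    using diag_op_bounded_linear[OF on, of "\<lambda>_. 1" 1] diag_op_orthonormal[OF on, of "\<lambda>_. 1" 1]
    by (intro bounded_linear_eq_on_onb[OF E]) (auto simp: bounded_linear_ident)
  with diag_op_has_sum[OF on, of "\<lambda>_. 1" 1 f] show ?thesis by simp
qed

lemma Parseval:
  fixes f :: "'h::{real_inner, banach}"
  assumes "is_onb E"
  shows "((\<lambda>e. (e \<bullet> f) * (e \<bullet> h)) has_sum (f \<bullet> h)) E"
  using has_sum_bounded_linear[OF bounded_linear_inner_left onb_expansion[OF assms], of f h] by simp

lemma Parseval_norm:
  fixes f :: "'h::{real_inner, banach}"
  assumes "is_onb E"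
  shows "((\<lambda>e. (e \<bullet> f)\<^sup>2) has_sum (norm f)\<^sup>2) E"
  using Parseval[OF assms, of f f] by (simp add: power2_eq_square norm_eq_sqrt_inner)

text \<open>Subtracting from \<open>f\<close> its Fourier series leaves a vector orthogonal to
  \<open>E\<close>, which is zero by maximality. So \<open>f\<close> is a limit of finite
  combinations of \<open>E\<close>.\<close>

lemma is_onbI:
  fixes E :: "'h::{real_inner, banach} set"
  assumes on: "orthonormal_on (\<lambda>e. e) E" and max: "\<And>f. (\<And>e. e \<in> E \<Longrightarrow> e \<bullet> f = 0) \<Longrightarrow> f = 0"
  shows "is_onb E"
proof -
  have "f \<in> closure (span E)" for f
  proof -
    let ?s = "diag_op (\<lambda>e. e) E (\<lambda>_. 1) f"
    have sum: "((\<lambda>e. (e \<bullet> f) *\<^sub>R e) has_sum ?s) E"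
      using diag_op_has_sum[OF on, of "\<lambda>_. 1" 1 f] by simp
    have "f - ?s = 0"
      using orthonormal_has_sum_inner[OF on sum] by (intro max) (simp add: inner_diff_right)
    then have "(sum (\<lambda>e. (e \<bullet> f) *\<^sub>R e) \<longlongrightarrow> f) (finite_subsets_at_top E)"
      using sum by (simp add: has_sum_def)
    moreover have "\<forall>\<^sub>F F in finite_subsets_at_top E. (\<Sum>e\<in>F. (e \<bullet> f) *\<^sub>R e) \<in> closure (span E)"
      by (intro eventually_finite_subsets_at_top_weakI closure_subset[THEN subsetD] span_sum span_scale)
         (auto intro: span_base)
    ultimately show ?thesis
      by (intro Lim_in_closed_set[OF closed_closure]) auto
  qed
  then show ?thesis
    using on by (auto simp: is_onb_def orthonormal_on_def norm_eq_1 pairwise_def orthogonal_def)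
qed

text \<open>Distinct elements lie at distance \<open>sqrt 2\<close>, so points of a countable dense
  set chosen within \<open>1/2\<close> of them are distinct.\<close>

lemma countable_orthonormal:
  fixes E :: "'h::{real_inner, second_countable_topology} set"
  assumes on: "orthonormal_on (\<lambda>e. e) E"
  shows "countable E"
proof -
  obtain D :: "'h set" where D: "countable D" "\<And>X. open X \<Longrightarrow> X \<noteq> {} \<Longrightarrow> \<exists>d\<in>D. d \<in> X"
    using countable_dense_exists by metis
  have "\<exists>d\<in>D. d \<in> ball e (1/2)" for e by (intro D(2)) auto
  then obtain d where d: "\<And>e. d e \<in> D" "\<And>e. dist e (d e) < 1/2"
    by (metis mem_ball)
  have "inj_on d E"
  proof (rule inj_onI, rule ccontr)
    fix e e' assume e: "e \<in> E" "e' \<in> E" "d e = d e'" "e \<noteq> e'"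
    have "(dist e e')\<^sup>2 = 2"
      using e orthonormal_onD[OF on, of e e'] orthonormal_onD[OF on, of e' e]
        orthonormal_onD[OF on, of e e] orthonormal_onD[OF on, of e' e']
      by (simp add: dist_norm power2_norm_eq_inner inner_diff_left inner_diff_right)
    moreover have "dist e e' < 1"
      using d(2)[of e] d(2)[of e'] e(3) dist_triangle_half_l[of e "d e" 1 e'] by simp
    then have "(dist e e')\<^sup>2 < 1\<^sup>2" by (intro power_strict_mono) auto
    ultimately show False by simp
  qed
  moreover have "countable (d ` E)"
    using D(1) d(1) by (auto intro: countable_subset)
  ultimately show ?thesis by (rule countable_image_inj_on[rotated])
qed

text \<open>Zorn's lemma. With \<open>Q\<close> saying that a vector is an eigenvector, maximality
  means that no unit eigenvector is orthogonal to all of \<open>E\<close>.\<close>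

lemma maximal_orthonormal:
  fixes E0 :: "'h::real_inner set"
  assumes "orthonormal_on (\<lambda>e. e) E0" "\<And>e. e \<in> E0 \<Longrightarrow> Q e"
  shows "\<exists>E. E0 \<subseteq> E \<and> orthonormal_on (\<lambda>e. e) E \<and> (\<forall>e\<in>E. Q e) \<and>
    (\<forall>v. norm v = 1 \<longrightarrow> Q v \<longrightarrow> (\<exists>e\<in>E. e \<bullet> v \<noteq> 0))"
proof -
  let ?A = "{E. E0 \<subseteq> E \<and> orthonormal_on (\<lambda>e. e) E \<and> (\<forall>e\<in>E. Q e)}"
  have "\<exists>E\<in>?A. \<forall>X\<in>?A. E \<subseteq> X \<longrightarrow> X = E"
  proof (rule subset_Zorn_nonempty)
    show "?A \<noteq> {}" using assms by blast
    fix \<C> assume C: "\<C> \<noteq> {}" "subset.chain ?A \<C>"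
    have sub: "X \<in> ?A" if "X \<in> \<C>" for X
      using C(2) that unfolding subset_chain_def by blast
    have lin: "X \<subseteq> Y \<or> Y \<subseteq> X" if "X \<in> \<C>" "Y \<in> \<C>" for X Y
      using C(2) that unfolding subset_chain_def by blast
    have "orthonormal_on (\<lambda>e. e) (\<Union>\<C>)"
      unfolding orthonormal_on_def
    proof (intro ballI)
      fix x y assume "x \<in> \<Union>\<C>" "y \<in> \<Union>\<C>"
      then obtain X Y where XY: "X \<in> \<C>" "x \<in> X" "Y \<in> \<C>" "y \<in> Y" by blast
      then obtain Z where "Z \<in> \<C>" "x \<in> Z" "y \<in> Z" using lin[of X Y] by blast
      then show "x \<bullet> y = (if x = y then 1 else 0)"
        using sub[of Z] by (simp add: orthonormal_on_def)
    qed
    moreover have "E0 \<subseteq> \<Union>\<C>" using C(1) sub by fast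
    moreover have "\<forall>e\<in>\<Union>\<C>. Q e" using sub by fast
    ultimately show "\<Union>\<C> \<in> ?A" by simp
  qed
  then obtain E where E: "E \<in> ?A" and max: "\<forall>X\<in>?A. E \<subseteq> X \<longrightarrow> X = E" ..
  have "\<exists>e\<in>E. e \<bullet> v \<noteq> 0" if v: "norm v = 1" "Q v" for v
  proof (rule ccontr)
    assume "\<not> ?thesis"
    then have ort: "\<And>e. e \<in> E \<Longrightarrow> e \<bullet> v = 0" by blast
    have "orthonormal_on (\<lambda>e. e) (insert v E)"
      using E ort v(1) by (auto simp: orthonormal_on_def norm_eq_1 inner_commute)
    then have "insert v E \<in> ?A" using E v(2) by auto
    with max have "insert v E = E" by blast
    then have "v \<in> E" by blast
    with ort[of v] v(1) show False by simp
  qed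
  then show ?thesis using E by (intro exI[of _ E]) simp
qed

section \<open>The spectral theorem for positive compact operators\<close>

definition compact_op :: "('h::real_normed_vector \<Rightarrow> 'h) \<Rightarrow> bool" where
  "compact_op A \<longleftrightarrow> (\<forall>f :: nat \<Rightarrow> 'h. bounded (range f) \<longrightarrow>
     (\<exists>r l. strict_mono r \<and> (\<lambda>n. A (f (r n))) \<longlonglongrightarrow> l))"

text \<open>Maximize the quadratic form over the unit sphere of \<open>V\<close>. A maximizing
  sequence consists of approximate eigenvectors for the supremum \<open>s\<close>, and compactness
  extracts a limit, which is an exact one.\<close>

lemma positive_compact_eigenvector:
  fixes A :: "'h::{real_inner, banach} \<Rightarrow> 'h"
  assumes A: "positive_op A" "compact_op A"
    and V: "subspace V" "closed V" "\<And>v. v \<in> V \<Longrightarrow> A v \<in> V"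
    and v: "v \<in> V" "v \<noteq> 0"
  shows "\<exists>u\<in>V. norm u = 1 \<and> A u = (A u \<bullet> u) *\<^sub>R u"
proof -
  have bl: "bounded_linear A" and sa: "\<And>f h. A f \<bullet> h = f \<bullet> A h" and pos: "\<And>f. 0 \<le> A f \<bullet> f"
    using A(1) by (auto simp: positive_op_def)
  interpret bounded_linear A by (fact bl)
  obtain C where C: "\<And>f. norm (A f) \<le> norm f * C" using bounded by blast
  let ?S = "{f \<in> V. norm f = 1}"
  define s where "s = (SUP f\<in>?S. A f \<bullet> f)"
  have "sgn v \<in> ?S" using v V(1) by (auto simp: norm_sgn sgn_div_norm subspace_scale)
  then have ne: "?S \<noteq> {}" by blast
  have "A f \<bullet> f \<le> C" if "norm f = 1" for f
    using norm_cauchy_schwarz[of "A f" f] C[of f] that by simp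
  then have bdd: "bdd_above ((\<lambda>f. A f \<bullet> f) ` ?S)" by (intro bdd_aboveI[where M = C]) auto
  have le_s: "A f \<bullet> f \<le> s" if "f \<in> ?S" for f
    unfolding s_def using that bdd by (rule cSUP_upper)
  have s0: "0 \<le> s" using le_s[OF \<open>sgn v \<in> ?S\<close>] pos[of "sgn v"] by linarith
  have le: "A f \<bullet> f \<le> s * (norm f)\<^sup>2" if "f \<in> V" for f
  proof (cases "f = 0")
    case False
    then have "sgn f \<in> ?S" using that V(1) by (auto simp: norm_sgn sgn_div_norm subspace_scale)
    from le_s[OF this] have "A (sgn f) \<bullet> sgn f \<le> s" .
    then show ?thesis using False
      by (simp add: sgn_div_norm scaleR field_simps power2_eq_square)
  qed (simp add: zero)
  \<comment> \<open>Positivity of the form at \<open>f - t *\<^sub>R A f\<close> gives a quadratic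
    inequality in \<open>t\<close>. Its best choice is \<open>t = 1/s\<close>; for
    \<open>s = 0\<close> already \<open>t = 1\<close> forces \<open>A f = 0\<close>.\<close>
  have norm_le: "(norm (A f))\<^sup>2 \<le> s * (A f \<bullet> f)" if f: "f \<in> V" for f
  proof -
    have quad: "0 \<le> A f \<bullet> f - 2 * t * (norm (A f))\<^sup>2 + t\<^sup>2 * (s * (norm (A f))\<^sup>2)" for t
    proof -
      have "0 \<le> A (f - t *\<^sub>R A f) \<bullet> (f - t *\<^sub>R A f)" by (rule pos)
      also have "\<dots> = A f \<bullet> f - 2 * t * (norm (A f))\<^sup>2 + t\<^sup>2 * (A (A f) \<bullet> A f)"
        using sa[of "A f" f]
        by (simp add: diff scaleR inner_diff_left inner_diff_right power2_norm_eq_inner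
            power2_eq_square[of t] inner_commute algebra_simps)
      also have "\<dots> \<le> A f \<bullet> f - 2 * t * (norm (A f))\<^sup>2 + t\<^sup>2 * (s * (norm (A f))\<^sup>2)"
        using le[OF V(3)[OF f]] by (intro add_left_mono mult_left_mono) auto
      finally show ?thesis .
    qed
    show ?thesis
    proof (cases "s = 0")
      case True
      then show ?thesis using quad[of 1] le[OF f] zero_le_power2[of "norm (A f)"] unfolding True by linarith
    next
      case False
      then have "s > 0" using s0 by simp
      then show ?thesis using quad[of "1/s"] by (simp add: field_simps power2_eq_square)
    qed
  qed
  show ?thesis
  proof (cases "s = 0")
    case True
    \<comment> \<open>A vanishing supremum makes \<open>A\<close> zero on \<open>V\<close>, so any
      unit vector of \<open>V\<close> is an eigenvector for the eigenvalue zero.\<close>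
    then have "A (sgn v) = 0" using norm_le[of "sgn v"] \<open>sgn v \<in> ?S\<close> by simp
    then show ?thesis using \<open>sgn v \<in> ?S\<close> by (intro bexI[of _ "sgn v"]) auto
  next
    case False
    with s0 have s: "s > 0" by simp
    have "\<exists>f\<in>?S. s - inverse (Suc n) < A f \<bullet> f" for n
      unfolding s_def using less_cSUP_iff[OF ne bdd, of "s - inverse (Suc n)"]
      by (simp add: s_def)
    then obtain f where f: "\<And>n. f n \<in> ?S" "\<And>n. s - inverse (Suc n) < A (f n) \<bullet> f n" by metis
    have lim: "(\<lambda>n. A (f n) \<bullet> f n) \<longlonglongrightarrow> s"
    proof (rule tendsto_sandwich[OF _ _ _ tendsto_const])
      show "(\<lambda>n. s - inverse (Suc n)) \<longlonglongrightarrow> s"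
        using tendsto_diff[OF tendsto_const LIMSEQ_inverse_real_of_nat, of s] by simp
    qed (use f le_s in \<open>auto intro: less_imp_le always_eventually\<close>)
    have appr: "(\<lambda>n. A (f n) - s *\<^sub>R f n) \<longlonglongrightarrow> 0"
    proof -
      \<comment> \<open>Expanding the square and inserting \<open>norm_le\<close> bounds the defect
        by the gap between the form and its supremum.\<close>
      have le2: "(norm (A (f n) - s *\<^sub>R f n))\<^sup>2 \<le> s * (s - A (f n) \<bullet> f n)" for n
      proof -
        have "(norm (A (f n) - s *\<^sub>R f n))\<^sup>2
            = (norm (A (f n)))\<^sup>2 - 2 * s * (A (f n) \<bullet> f n) + s\<^sup>2 * (norm (f n))\<^sup>2"
          by (simp add: power2_norm_eq_inner inner_diff_left inner_diff_right inner_commute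
              power2_eq_square[of s] algebra_simps)
        also have "\<dots> \<le> s * (s - A (f n) \<bullet> f n)"
          using norm_le[of "f n"] f(1)[of n] by (simp add: power2_eq_square algebra_simps)
        finally show ?thesis .
      qed
      have "(\<lambda>n. sqrt (s * (s - A (f n) \<bullet> f n))) \<longlonglongrightarrow> sqrt (s * (s - s))"
        by (intro tendsto_intros lim)
      then have "(\<lambda>n. sqrt (s * (s - A (f n) \<bullet> f n))) \<longlonglongrightarrow> 0" by simp
      then show ?thesis
        by (rule Lim_null_comparison[rotated]) (auto intro!: always_eventually real_le_rsqrt le2)
    qed
    have "bounded (range f)" using f(1) by (auto intro!: boundedI[where B = 1])
    then obtain r l where r: "strict_mono (r :: nat \<Rightarrow> nat)" and l: "(\<lambda>n. A (f (r n))) \<longlonglongrightarrow> l"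
      using A(2) unfolding compact_op_def by blast
    define u where "u = (1/s) *\<^sub>R l"
    \<comment> \<open>This rewrites \<open>f (r n)\<close> through \<open>A (f (r n))\<close>, which
      converges, and the vanishing defect; so the maximizing sequence itself converges in
      norm.\<close>
    have "(\<lambda>n. (1/s) *\<^sub>R (A (f (r n)) - (A (f (r n)) - s *\<^sub>R f (r n)))) \<longlonglongrightarrow> (1/s) *\<^sub>R (l - 0)"
      using LIMSEQ_subseq_LIMSEQ[OF appr r] by (intro tendsto_intros l) (simp add: o_def)
    then have lim_u: "(\<lambda>n. f (r n)) \<longlonglongrightarrow> u" using s by (simp add: u_def)
    have "u \<in> V"
      using V(2) _ lim_u by (rule closed_sequentially) (use f(1) in auto)
    moreover have "norm u = 1"
    proof -
      have "(\<lambda>n. norm (f (r n))) \<longlonglongrightarrow> norm u" by (intro tendsto_norm lim_u)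
      moreover have "(\<lambda>n. norm (f (r n))) = (\<lambda>_. 1)" using f(1) by auto
      ultimately have "(\<lambda>_ :: nat. 1) \<longlonglongrightarrow> norm u" by (simp only:)
      then show ?thesis by (simp only: LIMSEQ_const_iff)
    qed
    moreover have "A u = (A u \<bullet> u) *\<^sub>R u"
    proof -
      have "A u = l" using LIMSEQ_unique[OF tendsto[OF lim_u] l] .
      also have "l = s *\<^sub>R u" using s by (simp add: u_def)
      finally have eq: "A u = s *\<^sub>R u" .
      then have "A u \<bullet> u = s * (norm u)\<^sup>2" by (metis inner_scaleR_left power2_norm_eq_inner)
      with \<open>norm u = 1\<close> have "A u \<bullet> u = s" by simp
      then show ?thesis using eq by metis
    qed
    ultimately show ?thesis by blast
  qed
qed

text \<open>The orthogonal complement of a maximal orthonormal set of eigenvectors is closed and, by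
  self-adjointness, invariant; were it nonzero it would contain another eigenvector. Prescribing
  \<open>E0\<close> lets the basis contain the eigenvectors that \<open>fun_calc\<close> happens to
  choose.\<close>

lemma positive_compact_eigenbasis:
  fixes A :: "'h::{real_inner, banach} \<Rightarrow> 'h"
  assumes A: "positive_op A" "compact_op A"
    and E0: "orthonormal_on (\<lambda>e. e) E0" "\<And>e. e \<in> E0 \<Longrightarrow> A e = (A e \<bullet> e) *\<^sub>R e"
  shows "\<exists>E. E0 \<subseteq> E \<and> is_onb E \<and> (\<forall>e\<in>E. A e = (A e \<bullet> e) *\<^sub>R e)"
proof -
  obtain E where E: "E0 \<subseteq> E" "orthonormal_on (\<lambda>e. e) E"
    "\<And>e. e \<in> E \<Longrightarrow> A e = (A e \<bullet> e) *\<^sub>R e"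
    and max: "\<And>v. norm v = 1 \<Longrightarrow> A v = (A v \<bullet> v) *\<^sub>R v \<Longrightarrow> \<exists>e\<in>E. e \<bullet> v \<noteq> 0"
    using maximal_orthonormal[where Q = "\<lambda>e. A e = (A e \<bullet> e) *\<^sub>R e", OF E0] by auto
  have "is_onb E"
  proof (rule is_onbI[OF E(2)], rule ccontr)
    let ?V = "{v. \<forall>e\<in>E. e \<bullet> v = 0}"
    fix f assume f: "\<And>e. e \<in> E \<Longrightarrow> e \<bullet> f = 0" "f \<noteq> 0"
    have "\<exists>u\<in>?V. norm u = 1 \<and> A u = (A u \<bullet> u) *\<^sub>R u"
    proof (rule positive_compact_eigenvector[OF A])
      show "subspace ?V" by (auto simp: subspace_def inner_add_right)
      have "?V = (\<Inter>e\<in>E. {v. e \<bullet> v = 0})" by blast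
      then show "closed ?V" by (auto intro!: closed_INT closed_Collect_eq continuous_intros)
      fix v assume v: "v \<in> ?V"
      have "e \<bullet> A v = 0" if "e \<in> E" for e
      proof -
        have "e \<bullet> A v = A e \<bullet> v" using A(1) by (simp add: positive_op_def)
        also have "\<dots> = 0" using v that by (subst E(3)[OF that]) simp
        finally show ?thesis .
      qed
      then show "A v \<in> ?V" by blast
    qed (use f in auto)
    then show False using max by blast
  qed
  then show ?thesis using E(1,3) by (intro exI[of _ E] conjI ballI)
qed

text \<open>Ensures that the choice inside \<open>fun_calc\<close> picks a genuine
  decomposition.\<close>

lemma spectral_decomp_exists:
  fixes A :: "'h::{real_inner, banach, second_countable_topology} \<Rightarrow> 'h"
  assumes A: "positive_op A" "compact_op A"
  shows "\<exists>I \<tau> \<psi>. spectral_decomp A I \<tau> \<psi>"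
proof -
  obtain E where E: "is_onb E" "\<And>e. e \<in> E \<Longrightarrow> A e = (A e \<bullet> e) *\<^sub>R e"
    using positive_compact_eigenbasis[OF A, of "{}"] by (auto simp: orthonormal_on_def)
  note on = is_onb_orthonormal[OF E(1)]
  have cnt: "countable E" using countable_orthonormal[OF on] .
  \<comment> \<open>Indexing by the codes of basis vectors treats finite and infinite bases
    alike.\<close>
  let ?\<psi> = "from_nat_into E" and ?I = "to_nat_on E ` E"
  have bij: "bij_betw ?\<psi> ?I E"
    by (rule bij_betwI[where g = "to_nat_on E"]) (auto simp: cnt)
  have "spectral_decomp A ?I (\<lambda>i. A (?\<psi> i) \<bullet> ?\<psi> i) ?\<psi>"
    unfolding spectral_decomp_def
  proof (intro conjI allI ballI)
    fix i j assume "i \<in> ?I" "j \<in> ?I"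
    then show "?\<psi> i \<bullet> ?\<psi> j = (if i = j then 1 else 0)"
      using orthonormal_onD[OF on] cnt by auto
  next
    fix i show "0 \<le> A (?\<psi> i) \<bullet> ?\<psi> i" using A(1) unfolding positive_op_def by blast
  next
    fix f
    have "bounded_linear A" using A(1) by (simp add: positive_op_def)
    from has_sum_bounded_linear[OF this onb_expansion[OF E(1), of f]]
    have "((\<lambda>e. A ((e \<bullet> f) *\<^sub>R e)) has_sum A f) E" .
    also have "?this \<longleftrightarrow> ((\<lambda>e. (A e \<bullet> e) *\<^sub>R tensor_op e e f) has_sum A f) E"
    proof (rule has_sum_cong)
      fix e assume "e \<in> E"
      have "A ((e \<bullet> f) *\<^sub>R e) = (e \<bullet> f) *\<^sub>R A e"
        using \<open>bounded_linear A\<close> by (simp add: linear_simps)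
      also have "A e = (A e \<bullet> e) *\<^sub>R e" using E(2)[OF \<open>e \<in> E\<close>] .
      finally show "A ((e \<bullet> f) *\<^sub>R e) = (A e \<bullet> e) *\<^sub>R tensor_op e e f"
        by (simp add: tensor_op_def mult.commute)
    qed
    finally show "((\<lambda>i. (A (?\<psi> i) \<bullet> ?\<psi> i) *\<^sub>R tensor_op (?\<psi> i) (?\<psi> i) f) has_sum A f) ?I"
      using has_sum_reindex_bij_betw[OF bij, of "\<lambda>e. (A e \<bullet> e) *\<^sub>R tensor_op e e f" "A f"] by simp
  qed
  then show ?thesis by blast
qed

section \<open>Square roots and functional calculus in an eigenbasis\<close>

lemma op_sqrt_unique:
  assumes "positive_op S" "S \<circ> S = A" "\<And>T. positive_op T \<Longrightarrow> T \<circ> T = A \<Longrightarrow> T = S"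
  shows "op_sqrt A = S"
  unfolding op_sqrt_def by (rule the_equality) (use assms(1,2) in simp, use assms(3) in blast)

text \<open>On \<open>e\<close> the operator \<open>S\<^sup>2 - a\<close> factors as
  \<open>S + sqrt a\<close> after \<open>S - sqrt a\<close>, and positivity makes the first factor
  injective when \<open>a > 0\<close>. For \<open>a = 0\<close> the squared norm of
  \<open>S e\<close> is \<open>S (S e) \<bullet> e = 0\<close>.\<close>

lemma positive_sqrt_eigenvector:
  assumes S: "positive_op S" and e: "S (S e) = a *\<^sub>R e" and a: "0 \<le> a"
  shows "S e = sqrt a *\<^sub>R e"
proof -
  have bl: "bounded_linear S" and sa: "\<And>f h. S f \<bullet> h = f \<bullet> S h" and pos: "\<And>f. 0 \<le> S f \<bullet> f"
    using S by (auto simp: positive_op_def)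
  interpret bounded_linear S by (fact bl)
  show ?thesis
  proof (cases "a = 0")
    case True
    then have "S e \<bullet> S e = 0" using sa[of e "S e"] e by simp
    then show ?thesis using True by simp
  next
    case False
    let ?w = "S e - sqrt a *\<^sub>R e"
    have "S ?w + sqrt a *\<^sub>R ?w = S (S e) - (sqrt a * sqrt a) *\<^sub>R e"
      by (simp add: diff scaleR scaleR_diff_right)
    also have "\<dots> = 0" using e a by simp
    finally have "0 = (S ?w + sqrt a *\<^sub>R ?w) \<bullet> ?w" by simp
    also have "\<dots> = S ?w \<bullet> ?w + sqrt a * (?w \<bullet> ?w)" by (simp only: inner_add_left inner_scaleR_left)
    finally have "sqrt a * (?w \<bullet> ?w) \<le> 0" using pos[of ?w] by linarith
    moreover have "sqrt a > 0" using False a by simp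
    ultimately have "?w \<bullet> ?w \<le> 0" by (simp add: mult_le_0_iff)
    then have "?w \<bullet> ?w = 0" by (intro antisym inner_ge_zero)
    then have "?w = 0" by (simp only: inner_eq_zero_iff)
    then show ?thesis by simp
  qed
qed

section \<open>Operators with a complete set of eigenvectors\<close>

context
  fixes E :: "'h::{real_inner, banach} set" and A :: "'h \<Rightarrow> 'h" and a :: "'h \<Rightarrow> real"
  assumes E: "is_onb E" and bl: "bounded_linear A"
    and eig: "\<And>e. e \<in> E \<Longrightarrow> A e = a e *\<^sub>R e"
begin

lemma eigenvalue_le_onorm: "e \<in> E \<Longrightarrow> \<bar>a e\<bar> \<le> onorm A"
  using onorm[OF bl, of e] eig[of e] E by (simp add: is_onb_def)

lemma diagonal_op_eq: "A = diag_op (\<lambda>e. e) E a"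
  using diag_op_orthonormal[OF is_onb_orthonormal[OF E], of a "onorm A"] eigenvalue_le_onorm eig
  by (intro bounded_linear_eq_on_onb[OF E bl]
        diag_op_bounded_linear[OF is_onb_orthonormal[OF E], of a "onorm A"]) auto

lemma diagonal_op_self_adjoint: "A f \<bullet> h = f \<bullet> A h"
  using diag_op_self_adjoint[where a = a, OF is_onb_orthonormal[OF E] eigenvalue_le_onorm]
  by (simp flip: diagonal_op_eq)

lemma diagonal_op_inner: "((\<lambda>e. a e * (e \<bullet> f) * (e \<bullet> h)) has_sum (A f \<bullet> h)) E"
  using diag_op_inner[where a = a, OF is_onb_orthonormal[OF E] eigenvalue_le_onorm]
  by (simp flip: diagonal_op_eq)

text \<open>Taking roots of the eigenvalues gives one positive root. Any other one acts in the same
  way on each eigenvector, so the definite description in \<open>op_sqrt\<close> denotes it.\<close>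

lemma diagonal_op_sqrt:
  assumes pos: "\<And>e. e \<in> E \<Longrightarrow> 0 \<le> a e"
  shows "positive_op (op_sqrt A)" "op_sqrt A \<circ> op_sqrt A = A"
    "\<And>e. e \<in> E \<Longrightarrow> op_sqrt A e = sqrt (a e) *\<^sub>R e"
proof -
  note on = is_onb_orthonormal[OF E]
  let ?S = "diag_op (\<lambda>e. e) E (\<lambda>e. sqrt (a e))"
  have le: "\<bar>sqrt (a e)\<bar> \<le> sqrt (onorm A)" if "e \<in> E" for e
    using eigenvalue_le_onorm[OF that] pos[OF that] by simp
  have S: "positive_op ?S"
    using pos le by (intro diag_op_positive[OF on, of _ "sqrt (onorm A)"]) auto
  then have blS: "bounded_linear ?S" by (simp add: positive_op_def)
  have Se: "?S e = sqrt (a e) *\<^sub>R e" if "e \<in> E" for e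
    using diag_op_orthonormal[OF on, of "\<lambda>e. sqrt (a e)" "sqrt (onorm A)"] le that by auto
  have SS: "?S \<circ> ?S = A"
  proof (rule bounded_linear_eq_on_onb[OF E _ bl])
    show "bounded_linear (?S \<circ> ?S)" using bounded_linear_compose[OF blS blS] by (simp add: o_def)
    show "(?S \<circ> ?S) e = A e" if "e \<in> E" for e
      using that pos[OF that] by (simp add: Se eig linear_simps[OF blS])
  qed
  have "op_sqrt A = ?S"
  proof (rule op_sqrt_unique[OF S SS])
    fix T assume T: "positive_op T" "T \<circ> T = A"
    show "T = ?S"
    proof (rule bounded_linear_eq_on_onb[OF E _ blS])
      show "bounded_linear T" using T by (simp add: positive_op_def)
      show "T e = ?S e" if "e \<in> E" for e
        using positive_sqrt_eigenvector[OF T(1) _ pos[OF that]] fun_cong[OF T(2), of e] eig[OF that]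
          Se[OF that] by simp
    qed
  qed
  then show "positive_op (op_sqrt A)" "op_sqrt A \<circ> op_sqrt A = A"
    "\<And>e. e \<in> E \<Longrightarrow> op_sqrt A e = sqrt (a e) *\<^sub>R e"
    using S SS Se by simp_all
qed

text \<open>\<open>hs_norm\<close> uses an unknown basis \<open>E'\<close>. The double sum of
  \<open>(e' \<bullet> A e)\<^sup>2\<close> over \<open>E\<close> and \<open>E'\<close>, evaluated
  by Parseval in either order, carries the value over from the eigenbasis.\<close>

lemma diagonal_op_hs_norm:
  assumes sum: "((\<lambda>e. (a e)\<^sup>2) has_sum s) E"
  shows "hs_norm A = sqrt s"
proof -
  define E' :: "'h set" where "E' = (SOME E. is_onb E)"
  have E': "is_onb E'" unfolding E'_def using E by (rule someI)
  let ?f = "\<lambda>(e, e'). (e' \<bullet> A e)\<^sup>2"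
  have 1: "((\<lambda>e'. ?f (e, e')) has_sum (norm (A e))\<^sup>2) E'" for e
    using Parseval_norm[OF E', of "A e"] by simp
  have 2: "((\<lambda>e. (norm (A e))\<^sup>2) has_sum s) E"
  proof -
    have "(norm (A e))\<^sup>2 = (a e)\<^sup>2" if "e \<in> E" for e
      using E that by (simp add: eig is_onb_def power_mult_distrib)
    then show ?thesis using sum has_sum_cong by (metis (mono_tags, lifting))
  qed
  have "(?f has_sum s) (E \<times> E')"
    using 1 2 by (intro has_sum_SigmaI summable_on_SigmaI) (auto simp: summable_on_def)
  then have "((\<lambda>(x, y). ?f (y, x)) has_sum s) (E' \<times> E)"
    by (subst (asm) has_sum_swap)
  moreover have "((\<lambda>e. (\<lambda>(x, y). ?f (y, x)) (e', e)) has_sum (norm (A e'))\<^sup>2) E" for e'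
  proof -
    have "e' \<bullet> A e = e \<bullet> A e'" for e
      using diagonal_op_self_adjoint[of e' e] by (simp add: inner_commute)
    then show ?thesis using Parseval_norm[OF E, of "A e'"] by simp
  qed
  ultimately have "((\<lambda>e'. (norm (A e'))\<^sup>2) has_sum s) E'"
    by (rule has_sum_SigmaD)
  then show ?thesis unfolding hs_norm_def E'_def[symmetric] by (simp add: infsumI)
qed

end

text \<open>Eigenvalues bounded away from zero have bounded reciprocals, so the diagonal operator of
  the reciprocals is a bounded two-sided inverse.\<close>

lemma diagonal_op_inv:
  fixes E :: "'h::{real_inner, banach} set"
  assumes E: "is_onb E" and bl: "bounded_linear A"
    and eig: "\<And>e. e \<in> E \<Longrightarrow> A e = a e *\<^sub>R e" and c: "0 < c" "\<And>e. e \<in> E \<Longrightarrow> c \<le> a e"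
  shows "bounded_linear (inv A)" "\<And>e. e \<in> E \<Longrightarrow> inv A e = (1 / a e) *\<^sub>R e"
proof -
  note on = is_onb_orthonormal[OF E]
  let ?R = "diag_op (\<lambda>e. e) E (\<lambda>e. 1 / a e)"
  have pos: "0 < a e" if "e \<in> E" for e using c(1) c(2)[OF that] by linarith
  have le: "\<bar>1 / a e\<bar> \<le> 1 / c" if "e \<in> E" for e
    using pos[OF that] c(1) c(2)[OF that] by (simp add: frac_le)
  have blR: "bounded_linear ?R" by (rule diag_op_bounded_linear[OF on le])
  have Re: "?R e = (1 / a e) *\<^sub>R e" if "e \<in> E" for e
    by (rule diag_op_orthonormal[OF on le that])
  have "A \<circ> ?R = id"
    using bounded_linear_compose[OF bl blR] pos
    by (intro bounded_linear_eq_on_onb[OF E])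
       (auto simp: o_def id_def bounded_linear_ident Re eig linear_simps[OF bl] less_imp_neq[symmetric])
  moreover have "?R \<circ> A = id"
    using bounded_linear_compose[OF blR bl] pos
    by (intro bounded_linear_eq_on_onb[OF E])
       (auto simp: o_def id_def bounded_linear_ident Re eig linear_simps[OF blR] less_imp_neq[symmetric])
  ultimately have "inv A = ?R" by (rule inv_unique_comp)
  then show "bounded_linear (inv A)" "\<And>e. e \<in> E \<Longrightarrow> inv A e = (1 / a e) *\<^sub>R e"
    using blR Re by simp_all
qed

text \<open>\<open>R\<close> divides \<open>e\<close> by \<open>sqrt (t e + l)\<close>, so the
  sandwiched operator has the eigenvalues \<open>t e / (t e + l)\<close>.\<close>

lemma regularized_hs_norm:
  fixes E :: "'h::{real_inner, banach} set"
  assumes E: "is_onb E" and bl: "bounded_linear A" and l: "0 < l"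
    and eig: "\<And>e. e \<in> E \<Longrightarrow> A e = t e *\<^sub>R e" and t: "\<And>e. e \<in> E \<Longrightarrow> 0 \<le> t e"
    and sum: "((\<lambda>e. (t e / (t e + l))\<^sup>2) has_sum s) E"
    and R: "R = inv (op_sqrt (\<lambda>f. A f + l *\<^sub>R f))"
  shows "hs_norm (R \<circ> A \<circ> R) = sqrt s"
proof -
  let ?B = "\<lambda>f. A f + l *\<^sub>R f"
  have blB: "bounded_linear ?B"
    by (intro bounded_linear_add bl bounded_linear_scaleR_right)
  have eigB: "?B e = (t e + l) *\<^sub>R e" if "e \<in> E" for e
    using eig[OF that] by (simp add: scaleR_add_left)
  have "0 \<le> t e + l" if "e \<in> E" for e using t[OF that] l by simp
  note S = diagonal_op_sqrt[OF E blB eigB this]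
  have "bounded_linear (op_sqrt ?B)" using S(1) by (simp add: positive_op_def)
  \<comment> \<open>Since \<open>t e \<ge> 0\<close>, the eigenvalues of the root are at least
    \<open>sqrt l\<close>, which is the lower bound needed for inversion.\<close>
  note Rd = diagonal_op_inv[OF E this S(3), of "sqrt l", folded R]
  have blR: "bounded_linear R" using t l by (intro Rd(1)) auto
  have Re: "R e = (1 / sqrt (t e + l)) *\<^sub>R e" if "e \<in> E" for e using t l that by (intro Rd(2)) auto
  show ?thesis
  proof (rule diagonal_op_hs_norm[OF E _ _ sum])
    show "bounded_linear (R \<circ> A \<circ> R)"
      using bounded_linear_compose[OF blR bounded_linear_compose[OF bl blR]] by (simp add: o_def)
    show "(R \<circ> A \<circ> R) e = (t e / (t e + l)) *\<^sub>R e" if "e \<in> E" for e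
    proof -
      have "(R \<circ> A \<circ> R) e = (t e / (sqrt (t e + l) * sqrt (t e + l))) *\<^sub>R e"
        using that by (simp add: Re eig linear_simps[OF blR] linear_simps[OF bl])
      also have "sqrt (t e + l) * sqrt (t e + l) = t e + l" using t[OF that] l by simp
      finally show ?thesis .
    qed
  qed
qed

text \<open>The chosen eigenvectors are completed to an eigenbasis. Each added vector is annihilated
  by \<open>A\<close>, so the factor \<open>g 0\<close> used on the complement is again
  \<open>g\<close> at its eigenvalue. The bound \<open>k\<close> on the form keeps all eigenvalues
  where \<open>g\<close> is bounded.\<close>

lemma fun_calc_eigenbasis:
  fixes A :: "'h::{real_inner, banach, second_countable_topology} \<Rightarrow> 'h"
  assumes A: "positive_op A" "compact_op A"
    and k: "0 \<le> k" "\<And>f. norm f = 1 \<Longrightarrow> A f \<bullet> f \<le> k"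
    and g: "\<And>x. x \<in> {0..k} \<Longrightarrow> \<bar>g x\<bar> \<le> C"
  shows "bounded_linear (fun_calc g A) \<and> (\<exists>E. is_onb E \<and>
    (\<forall>e\<in>E. A e = (A e \<bullet> e) *\<^sub>R e \<and> fun_calc g A e = g (A e \<bullet> e) *\<^sub>R e))"
proof -
  let ?z = "SOME (I, \<tau>, \<psi>). spectral_decomp A I \<tau> \<psi>"
  obtain I \<tau> \<psi> where z: "?z = (I, \<tau>, \<psi>)" by (cases ?z) auto
  have "\<exists>z. case z of (I, \<tau>, \<psi>) \<Rightarrow> spectral_decomp A I \<tau> \<psi>"
    using spectral_decomp_exists[OF A] by auto
  then have "case ?z of (I, \<tau>, \<psi>) \<Rightarrow> spectral_decomp A I \<tau> \<psi>" by (rule someI_ex)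
  then have sd: "spectral_decomp A I \<tau> \<psi>" unfolding z by simp
  have on: "orthonormal_on \<psi> I" and \<tau>0: "\<And>i. i \<in> I \<Longrightarrow> 0 \<le> \<tau> i"
    and sum: "\<And>f. ((\<lambda>i. (\<tau> i * (\<psi> i \<bullet> f)) *\<^sub>R \<psi> i) has_sum A f) I"
    using sd by (auto simp: spectral_decomp_def orthonormal_on_def tensor_op_def)
  have A\<psi>: "A (\<psi> i) = \<tau> i *\<^sub>R \<psi> i" if "i \<in> I" for i
  proof -
    have "((\<lambda>j. (\<tau> j * (\<psi> j \<bullet> \<psi> i)) *\<^sub>R \<psi> j) has_sum \<tau> i *\<^sub>R \<psi> i) I"
      using that on by (intro has_sum_finite_neutralI[where B = "{i}"]) (auto simp: orthonormal_onD)
    from has_sum_unique[OF sum this] show ?thesis .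
  qed
  have A\<psi>\<psi>: "A (\<psi> i) \<bullet> \<psi> i = \<tau> i" if "i \<in> I" for i
    using that on by (simp add: A\<psi> orthonormal_onD)
  have g\<tau>: "\<bar>g (\<tau> i)\<bar> \<le> C" if "i \<in> I" for i
    using k(2)[of "\<psi> i"] \<tau>0[OF that] that by (intro g) (simp add: A\<psi>\<psi> orthonormal_on_norm[OF on])
  have inj: "i = j" if "i \<in> I" "j \<in> I" "\<psi> i = \<psi> j" for i j
    using orthonormal_onD[OF on, of i j] orthonormal_onD[OF on, of j j] that by (simp split: if_splits)
  have on': "orthonormal_on (\<lambda>e. e) (\<psi> ` I)"
    using on inj by (auto simp: orthonormal_on_def)
  have eig: "A e = (A e \<bullet> e) *\<^sub>R e" if "e \<in> \<psi> ` I" for e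
  proof -
    from that obtain i where i: "i \<in> I" "e = \<psi> i" by blast
    show ?thesis unfolding i(2) A\<psi>\<psi>[OF i(1)] by (rule A\<psi>[OF i(1)])
  qed
  obtain E where E: "\<psi> ` I \<subseteq> E" "is_onb E" "\<And>e. e \<in> E \<Longrightarrow> A e = (A e \<bullet> e) *\<^sub>R e"
    using positive_compact_eigenbasis[OF A on' eig] by auto
  let ?G = "diag_op \<psi> I (\<lambda>i. g (\<tau> i))" and ?P = "diag_op \<psi> I (\<lambda>_. 1)"
  have fc: "fun_calc g A = (\<lambda>f. ?G f + g 0 *\<^sub>R (f - ?P f))"
    unfolding fun_calc_def z by (simp add: tensor_op_def diag_op_def fun_eq_iff)
  have "bounded_linear ?G" by (rule diag_op_bounded_linear[OF on g\<tau>])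
  moreover have "bounded_linear ?P" by (rule diag_op_bounded_linear[OF on, of _ 1]) simp
  ultimately have "bounded_linear (fun_calc g A)"
    unfolding fc by (intro bounded_linear_add bounded_linear_sub bounded_linear_ident
        bounded_linear_compose[OF bounded_linear_scaleR_right])
  moreover have "fun_calc g A e = g (A e \<bullet> e) *\<^sub>R e" if e: "e \<in> E" for e
  proof (cases "e \<in> \<psi> ` I")
    case True
    then obtain i where i: "i \<in> I" "e = \<psi> i" by blast
    have "?G e = g (\<tau> i) *\<^sub>R e" unfolding i(2) by (rule diag_op_orthonormal[OF on g\<tau> i(1)])
    moreover have "?P e = 1 *\<^sub>R e" unfolding i(2) by (rule diag_op_orthonormal[OF on _ i(1), of _ 1]) simp
    ultimately show ?thesis using A\<psi>\<psi>[OF i(1)] by (simp add: fc i(2))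
  next
    case False
    have 0: "\<psi> i \<bullet> e = 0" if "i \<in> I" for i
    proof -
      have "\<psi> i \<in> E" "\<psi> i \<noteq> e" using that E(1) False by auto
      then show ?thesis using orthonormal_onD[OF is_onb_orthonormal[OF E(2)], of "\<psi> i" e] e by simp
    qed
    have z: "diag_op \<psi> I b e = 0" for b
      unfolding diag_op_def by (rule infsum_0) (simp add: 0)
    have "((\<lambda>i. (\<tau> i * (\<psi> i \<bullet> e)) *\<^sub>R \<psi> i) has_sum 0) I" by (rule has_sum_0) (simp add: 0)
    from has_sum_unique[OF sum this] have "A e = 0" .
    then show ?thesis by (simp add: fc z)
  qed
  ultimately show ?thesis using E(2,3) by (intro conjI exI[of _ E] ballI)
qed

section \<open>Second moment operators\<close>

text \<open>Models the centered feature map. The uniform bound makes every integral below exist and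
  supplies the dominating constants.\<close>

locale bounded_feature = prob_space P
  for P :: "'a measure" +
  fixes c :: "'a \<Rightarrow> 'h::{real_inner, banach, second_countable_topology}" and B :: real
  assumes c_measurable [measurable]: "c \<in> borel_measurable P"
    and c_bound: "norm (c x) \<le> B"
begin

definition second_moment_op :: "'h \<Rightarrow> 'h" where
  "second_moment_op f = (\<integral>x. tensor_op (c x) (c x) f \<partial>P)"

lemma B_nonneg: "0 \<le> B"
  using norm_ge_zero c_bound by (rule order_trans)

lemma integrable_bounded:
  fixes u :: "'a \<Rightarrow> 'b::{banach, second_countable_topology}"
  assumes "u \<in> borel_measurable P" "\<And>x. norm (u x) \<le> C"
  shows "integrable P u"
  using assms by (intro integrable_const_bound[where B = C]) auto

lemma integrable_c: "integrable P c"
  by (rule integrable_bounded[OF c_measurable c_bound])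

lemma abs_inner_c_le: "\<bar>c x \<bullet> f\<bar> \<le> B * norm f"
  using Cauchy_Schwarz_ineq2[of "c x" f] mult_right_mono[OF c_bound[of x], of "norm f"] by simp

lemma norm_tensor_le: "norm (tensor_op (c x) (c x) f) \<le> B * norm f * B"
  unfolding tensor_op_def using abs_inner_c_le[of x f] c_bound[of x] B_nonneg
  by (auto intro!: mult_mono)

lemma integrable_tensor: "integrable P (\<lambda>x. tensor_op (c x) (c x) f)"
  using norm_tensor_le by (intro integrable_bounded[where C = "B * norm f * B"]) (auto simp: tensor_op_def)

lemma integrable_inner_power2: "integrable P (\<lambda>x. (c x \<bullet> f)\<^sup>2)"
  using power_mono[where n = 2, OF abs_inner_c_le[of _ f]]
  by (intro integrable_bounded[where C = "(B * norm f)\<^sup>2"]) auto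

lemma second_moment_op_inner: "second_moment_op f \<bullet> h = (\<integral>x. (c x \<bullet> f) * (c x \<bullet> h) \<partial>P)"
  unfolding second_moment_op_def
  by (subst integral_inner_left[symmetric], rule integrable_tensor) (simp add: tensor_op_def)

lemma second_moment_op_quadratic: "second_moment_op f \<bullet> f = (\<integral>x. (c x \<bullet> f)\<^sup>2 \<partial>P)"
  by (simp add: second_moment_op_inner power2_eq_square)

lemma second_moment_op_positive: "positive_op second_moment_op"
  unfolding positive_op_def
proof (intro conjI allI)
  show "bounded_linear second_moment_op"
  proof (rule bounded_linear_intro)
    fix f h r
    have "second_moment_op (f + h) = (\<integral>x. tensor_op (c x) (c x) f + tensor_op (c x) (c x) h \<partial>P)"
      unfolding second_moment_op_def by (simp add: tensor_op_def inner_add_right scaleR_add_left)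
    then show "second_moment_op (f + h) = second_moment_op f + second_moment_op h"
      unfolding second_moment_op_def by (simp add: integrable_tensor)
    have "second_moment_op (r *\<^sub>R f) = (\<integral>x. r *\<^sub>R tensor_op (c x) (c x) f \<partial>P)"
      unfolding second_moment_op_def by (simp add: tensor_op_def)
    then show "second_moment_op (r *\<^sub>R f) = r *\<^sub>R second_moment_op f"
      unfolding second_moment_op_def by (simp add: integrable_tensor)
    have "norm (second_moment_op f) \<le> (\<integral>x. norm (tensor_op (c x) (c x) f) \<partial>P)"
      unfolding second_moment_op_def by (rule integral_norm_bound)
    also have "\<dots> \<le> (\<integral>x. B * norm f * B \<partial>P)"
      by (intro integral_mono integrable_norm integrable_tensor norm_tensor_le) simp
    also have "\<dots> = norm f * (B * B)" by (simp add: prob_space)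
    finally show "norm (second_moment_op f) \<le> norm f * (B * B)" .
  qed
  fix f h
  show "second_moment_op f \<bullet> h = f \<bullet> second_moment_op h"
    using second_moment_op_inner[of f h] second_moment_op_inner[of h f]
    by (simp add: mult.commute inner_commute)
  show "0 \<le> second_moment_op f \<bullet> f"
    by (simp add: second_moment_op_quadratic)
qed

text \<open>
  A bounded sequence has a subsequence along which all inner products converge, and then the
  integrands converge pointwise.
\<close>

lemma second_moment_op_compact: "compact_op second_moment_op"
  unfolding compact_op_def
proof (intro allI impI)
  fix f :: "nat \<Rightarrow> 'h" assume "bounded (range f)"
  then obtain R where R: "\<And>n. norm (f n) \<le> R" unfolding bounded_iff by auto
  obtain D :: "'h set" where D: "countable D" "\<And>X. open X \<Longrightarrow> X \<noteq> {} \<Longrightarrow> \<exists>d\<in>D. d \<in> X"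
    using countable_dense_exists by metis
  \<comment> \<open>Normalizing \<open>d\<close> makes the bound uniform over the dense set, as the
    diagonal extraction of a subsequence requires; \<open>conv_D\<close> undoes the scaling.\<close>
  have "norm (f n \<bullet> sgn d) \<le> R" for n d
  proof -
    have "norm (f n \<bullet> sgn d) \<le> norm (f n) * norm (sgn d)" using Cauchy_Schwarz_ineq2 by simp
    also have "\<dots> \<le> norm (f n)" by (simp add: norm_sgn)
    finally show ?thesis using R[of n] by linarith
  qed
  then obtain r where r: "strict_mono (r :: nat \<Rightarrow> nat)"
    and lim_sgn: "\<And>d. d \<in> D \<Longrightarrow> \<exists>l. (\<lambda>n. f (r n) \<bullet> sgn d) \<longlonglongrightarrow> l"
    using function_convergent_subsequence[OF D(1), of "\<lambda>n d. f n \<bullet> sgn d" R] by metis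
  have conv_D: "convergent (\<lambda>n. f (r n) \<bullet> d)" if d: "d \<in> D" for d
  proof -
    obtain l where "(\<lambda>n. f (r n) \<bullet> sgn d) \<longlonglongrightarrow> l" using lim_sgn[OF d] by blast
    then have "(\<lambda>n. norm d * (f (r n) \<bullet> sgn d)) \<longlonglongrightarrow> norm d * l" by (intro tendsto_intros)
    moreover have "norm d * (u \<bullet> sgn d) = u \<bullet> d" for u
      by (cases "d = 0") (auto simp: sgn_div_norm)
    ultimately show ?thesis by (auto simp: convergent_def)
  qed
  have conv: "convergent (\<lambda>n. f (r n) \<bullet> v)" for v
  proof (rule Cauchy_convergent, rule metric_CauchyI)
    fix e :: real assume e: "e > 0"
    have "0 \<le> R" using R[of 0] norm_ge_zero[of "f 0"] by linarith
    \<comment> \<open>Chosen so that replacing \<open>v\<close> by \<open>d\<close> costs at most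
      \<open>e / 4\<close> at each of two indices; \<open>R + 1\<close> avoids division by
      zero.\<close>
    define \<delta> where "\<delta> = e / (4 * (R + 1))"
    have \<delta>: "\<delta> > 0" using e \<open>0 \<le> R\<close> by (simp add: \<delta>_def)
    have "\<exists>d\<in>D. d \<in> ball v \<delta>" using \<delta> by (intro D(2)) auto
    then obtain d where d: "d \<in> D" "norm (v - d) < \<delta>" by (auto simp: dist_norm)
    have near: "\<bar>f n \<bullet> v - f n \<bullet> d\<bar> \<le> e / 4" for n
    proof -
      have "\<bar>f n \<bullet> v - f n \<bullet> d\<bar> = \<bar>f n \<bullet> (v - d)\<bar>" by (simp add: inner_diff_right)
      also have "\<dots> \<le> norm (f n) * norm (v - d)" by (rule Cauchy_Schwarz_ineq2)
      also have "\<dots> \<le> (R + 1) * \<delta>" using R[of n] d(2) \<open>0 \<le> R\<close> by (intro mult_mono) auto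
      also have "\<dots> = e / 4" using \<open>0 \<le> R\<close> by (simp add: \<delta>_def field_simps)
      finally show ?thesis .
    qed
    obtain M where M: "\<And>m n. m \<ge> M \<Longrightarrow> n \<ge> M \<Longrightarrow> dist (f (r m) \<bullet> d) (f (r n) \<bullet> d) < e / 4"
      using metric_CauchyD[OF convergent_Cauchy[OF conv_D[OF d(1)]], of "e / 4"] e by auto
    show "\<exists>M. \<forall>m\<ge>M. \<forall>n\<ge>M. dist (f (r m) \<bullet> v) (f (r n) \<bullet> v) < e"
    proof (intro exI allI impI)
      fix m n assume "m \<ge> M" "n \<ge> M"
      from M[OF this] near[of "r m"] near[of "r n"] e
      show "dist (f (r m) \<bullet> v) (f (r n) \<bullet> v) < e" unfolding dist_real_def by arith
    qed
  qed
  define \<phi> where "\<phi> v = lim (\<lambda>n. f (r n) \<bullet> v)" for v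
  have \<phi>: "(\<lambda>n. f (r n) \<bullet> v) \<longlonglongrightarrow> \<phi> v" for v
    unfolding \<phi>_def using conv by (simp add: convergent_LIMSEQ_iff)
  have lim: "(\<lambda>n. tensor_op (c x) (c x) (f (r n))) \<longlonglongrightarrow> \<phi> (c x) *\<^sub>R c x" for x
    unfolding tensor_op_def using \<phi>[of "c x"] by (intro tendsto_intros) (simp add: inner_commute)
  have "(\<lambda>n. second_moment_op (f (r n))) \<longlonglongrightarrow> (\<integral>x. \<phi> (c x) *\<^sub>R c x \<partial>P)"
    unfolding second_moment_op_def
  proof (rule integral_dominated_convergence[where w = "\<lambda>_. B * R * B"])
    show m: "(\<lambda>x. tensor_op (c x) (c x) (f (r n))) \<in> borel_measurable P" for n
      unfolding tensor_op_def by measurable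
    show "(\<lambda>x. \<phi> (c x) *\<^sub>R c x) \<in> borel_measurable P"
      by (rule borel_measurable_LIMSEQ_metric[OF m lim])
    show "AE x in P. norm (tensor_op (c x) (c x) (f (r n))) \<le> B * R * B" for n
    proof (rule AE_I2)
      fix x
      have "B * norm (f (r n)) * B \<le> B * R * B"
        using R[of "r n"] B_nonneg by (intro mult_right_mono mult_left_mono) auto
      with norm_tensor_le[of x "f (r n)"]
      show "norm (tensor_op (c x) (c x) (f (r n))) \<le> B * R * B" by linarith
    qed
  qed (use lim in auto)
  with r show "\<exists>r l. strict_mono r \<and> (\<lambda>n. second_moment_op (f (r n))) \<longlonglongrightarrow> l" by blast
qed

text \<open>Finite trace: each partial sum is the expectation of a partial Bessel sum for
  \<open>c x\<close>, which is at most \<open>B\<^sup>2\<close>.\<close>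

lemma second_moment_op_trace:
  assumes on: "orthonormal_on (\<lambda>e. e) E"
  shows "(\<lambda>e. second_moment_op e \<bullet> e) summable_on E"
proof (rule nonneg_bdd_above_summable_on)
  show "0 \<le> second_moment_op e \<bullet> e" for e by (simp add: second_moment_op_quadratic)
  have "(\<Sum>e\<in>F. second_moment_op e \<bullet> e) \<le> B\<^sup>2" if F: "finite F" "F \<subseteq> E" for F
  proof -
    have "(\<Sum>e\<in>F. second_moment_op e \<bullet> e) = (\<integral>x. (\<Sum>e\<in>F. (c x \<bullet> e)\<^sup>2) \<partial>P)"
      by (simp add: second_moment_op_quadratic integrable_inner_power2)
    also have "\<dots> \<le> (\<integral>x. B\<^sup>2 \<partial>P)"
    proof (rule integral_mono)
      fix x
      have "(\<Sum>e\<in>F. (c x \<bullet> e)\<^sup>2) \<le> (norm (c x))\<^sup>2"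
        using Bessel_inequality_finite[OF on F, of "c x"] by (simp add: inner_commute)
      also have "\<dots> \<le> B\<^sup>2" using c_bound by (intro power_mono) auto
      finally show "(\<Sum>e\<in>F. (c x \<bullet> e)\<^sup>2) \<le> B\<^sup>2" .
    qed (simp_all add: integrable_inner_power2)
    finally show ?thesis by (simp add: prob_space)
  qed
  then show "bdd_above (sum (\<lambda>e. second_moment_op e \<bullet> e) ` {F. F \<subseteq> E \<and> finite F})"
    by (intro bdd_aboveI[where M = "B\<^sup>2"]) auto
qed

text \<open>Expand the form in the eigenbasis of \<open>W\<close>. Each term integrates to
  \<open>w e\<close> times the second moment in direction \<open>e\<close>, so every partial sum has
  expectation at most \<open>s\<close>, and dominated convergence passes to the limit.\<close>

lemma expectation_quadratic_form_le:
  assumes E: "is_onb E" and W: "bounded_linear W"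
    and eig: "\<And>e. e \<in> E \<Longrightarrow> W e = w e *\<^sub>R e" and w: "\<And>e. e \<in> E \<Longrightarrow> 0 \<le> w e"
    and sum: "((\<lambda>e. w e * (second_moment_op e \<bullet> e)) has_sum s) E"
  shows "(\<integral>x. W (c x) \<bullet> c x \<partial>P) \<le> s"
proof -
  have cnt: "countable E" by (rule countable_orthonormal[OF is_onb_orthonormal[OF E]])
  let ?I = "to_nat_on E ` E"
  define \<psi> where "\<psi> = from_nat_into E"
  have bij: "bij_betw \<psi> ?I E"
    unfolding \<psi>_def by (rule bij_betwI[where g = "to_nat_on E"]) (auto simp: cnt)
  then have \<psi>E: "\<psi> i \<in> E" if "i \<in> ?I" for i using that bij_betwE by blast
  \<comment> \<open>Padding with zeros outside the index set turns the unordered sum into a series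
    over the naturals, whose partial sums form the sequence needed for dominated
    convergence.\<close>
  let ?q = "\<lambda>x i. if i \<in> ?I then w (\<psi> i) * (c x \<bullet> \<psi> i)\<^sup>2 else 0"
  have reindex: "((\<lambda>i. if i \<in> ?I then u (\<psi> i) else 0) has_sum z) UNIV"
    if "(u has_sum z) E" for u :: "'h \<Rightarrow> real" and z
  proof -
    have "((\<lambda>i. u (\<psi> i)) has_sum z) ?I" using that by (simp add: has_sum_reindex_bij_betw[OF bij])
    then show ?thesis by (subst has_sum_cong_neutral[where T = ?I and g = "\<lambda>i. u (\<psi> i)"]) auto
  qed
  have q0: "0 \<le> ?q x i" for x i using w \<psi>E by auto
  have q: "(?q x has_sum (W (c x) \<bullet> c x)) UNIV" for x
  proof (rule reindex)
    have eq: "w e * (c x \<bullet> e)\<^sup>2 = w e * (e \<bullet> c x) * (e \<bullet> c x)" for e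
      by (simp add: power2_eq_square inner_commute mult.assoc)
    show "((\<lambda>e. w e * (c x \<bullet> e)\<^sup>2) has_sum (W (c x) \<bullet> c x)) E"
      unfolding eq by (rule diagonal_op_inner[OF E W eig])
  qed
  have q_le: "(\<Sum>i<n. ?q x i) \<le> W (c x) \<bullet> c x" for x n
    using q q0 by (intro finite_sum_le_has_sum[OF q]) auto
  have W_le: "W (c x) \<bullet> c x \<le> onorm W * B * B" for x
  proof -
    have "W (c x) \<bullet> c x \<le> norm (W (c x)) * norm (c x)" by (rule norm_cauchy_schwarz)
    also have "\<dots> \<le> (onorm W * norm (c x)) * norm (c x)" by (intro mult_right_mono onorm[OF W]) simp
    also have "\<dots> \<le> onorm W * B * B"
      using c_bound[of x] onorm_pos_le[OF W] B_nonneg by (intro mult_mono mult_left_mono) auto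
    finally show ?thesis .
  qed
  have meas: "(\<lambda>x. \<Sum>i<n. ?q x i) \<in> borel_measurable P" for n
    by measurable
  have lim: "(\<lambda>n. \<Sum>i<n. ?q x i) \<longlonglongrightarrow> W (c x) \<bullet> c x" for x
    using has_sum_imp_sums[OF q] by (simp add: sums_def)
  have "(\<lambda>n. \<integral>x. (\<Sum>i<n. ?q x i) \<partial>P) \<longlonglongrightarrow> (\<integral>x. W (c x) \<bullet> c x \<partial>P)"
  proof (rule integral_dominated_convergence[where w = "\<lambda>_. onorm W * B * B"])
    show "(\<lambda>x. W (c x) \<bullet> c x) \<in> borel_measurable P"
      by (rule borel_measurable_LIMSEQ_metric[OF meas lim])
    show "AE x in P. norm (\<Sum>i<n. ?q x i) \<le> onorm W * B * B" for n
    proof (rule AE_I2)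
      fix x
      have "0 \<le> (\<Sum>i<n. ?q x i)" by (rule sum_nonneg) (rule q0)
      then show "norm (\<Sum>i<n. ?q x i) \<le> onorm W * B * B" using q_le[of x n] W_le[of x] by simp
    qed
  qed (use lim meas in auto)
  moreover have "(\<integral>x. (\<Sum>i<n. ?q x i) \<partial>P) \<le> s" for n
  proof -
    have "integrable P (\<lambda>x. ?q x i)" for i
      by (cases "i \<in> ?I") (simp_all add: integrable_inner_power2)
    then have "(\<integral>x. (\<Sum>i<n. ?q x i) \<partial>P) = (\<Sum>i<n. \<integral>x. ?q x i \<partial>P)"
      by (rule Bochner_Integration.integral_sum)
    also have "\<dots> = (\<Sum>i<n. if i \<in> ?I then w (\<psi> i) * (second_moment_op (\<psi> i) \<bullet> \<psi> i) else 0)"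
      by (intro sum.cong refl) (simp add: second_moment_op_quadratic)
    also have "\<dots> \<le> s"
    proof (rule finite_sum_le_has_sum[OF reindex[OF sum]])
      fix i
      show "0 \<le> (if i \<in> ?I then w (\<psi> i) * (second_moment_op (\<psi> i) \<bullet> \<psi> i) else 0)"
        using w \<psi>E by (auto simp: second_moment_op_quadratic)
    qed auto
    finally show ?thesis .
  qed
  ultimately show ?thesis by (intro LIMSEQ_le_const2) auto
qed

end

section \<open>Degenerate U-statistics\<close>

context bounded_feature
begin

context
  fixes G :: "'h \<Rightarrow> 'h" and J :: "'i set"
  assumes G: "bounded_linear G" and G_sa: "\<And>f h. G f \<bullet> h = f \<bullet> G h"
    and mean: "(\<integral>x. c x \<partial>P) = 0" and J: "finite J"
begin

lemma kernel_measurable: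
  assumes "i \<in> J" "j \<in> J"
  shows "(\<lambda>x. G (c (x i)) \<bullet> c (x j)) \<in> borel_measurable (Pi\<^sub>M J (\<lambda>_. P))"
proof -
  have [measurable]: "G \<in> borel_measurable borel"
    using G by (intro borel_measurable_continuous_onI linear_continuous_on)
  have [measurable]: "(\<lambda>x. c (x k)) \<in> borel_measurable (Pi\<^sub>M J (\<lambda>_. P))" if "k \<in> J" for k
    by (rule measurable_compose[OF measurable_component_singleton[OF that, of "\<lambda>_. P"] c_measurable])
  show ?thesis using assms by measurable
qed

lemma kernel_bound: "\<bar>G (c x) \<bullet> c y\<bar> \<le> onorm G * B * B"
proof -
  have "\<bar>G (c x) \<bullet> c y\<bar> \<le> norm (G (c x)) * norm (c y)" by (rule Cauchy_Schwarz_ineq2)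
  also have "\<dots> \<le> (onorm G * norm (c x)) * norm (c y)" by (intro mult_right_mono onorm[OF G]) simp
  also have "\<dots> \<le> onorm G * B * B"
    using c_bound onorm_pos_le[OF G] B_nonneg by (intro mult_mono mult_left_mono) auto
  finally show ?thesis .
qed

lemma kernel_product_integrable:
  assumes "i \<in> J" "j \<in> J" "k \<in> J" "l \<in> J"
  shows "integrable (Pi\<^sub>M J (\<lambda>_. P)) (\<lambda>x. (G (c (x i)) \<bullet> c (x j)) * (G (c (x k)) \<bullet> c (x l)))"
proof -
  interpret Q: prob_space "Pi\<^sub>M J (\<lambda>_. P)" by (rule prob_space_PiM) (rule prob_space_axioms)
  show ?thesis
  proof (rule Q.integrable_const_bound[where B = "(onorm G * B * B) * (onorm G * B * B)"])
    show "AE x in Pi\<^sub>M J (\<lambda>_. P). norm ((G (c (x i)) \<bullet> c (x j)) * (G (c (x k)) \<bullet> c (x l)))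
        \<le> (onorm G * B * B) * (onorm G * B * B)"
      using kernel_bound onorm_pos_le[OF G] B_nonneg by (auto simp: abs_mult intro!: mult_mono)
    show "(\<lambda>x. (G (c (x i)) \<bullet> c (x j)) * (G (c (x k)) \<bullet> c (x l))) \<in> borel_measurable (Pi\<^sub>M J (\<lambda>_. P))"
      using assms by (intro borel_measurable_times kernel_measurable)
  qed
qed

text \<open>The index \<open>i\<close> occurs only once, so integrating out its coordinate first
  replaces \<open>c (x i)\<close> by its mean, which is zero.\<close>

lemma kernel_uncorrelated:
  assumes ijkl: "i \<in> J" "j \<in> J" "k \<in> J" "l \<in> J" and i: "i \<noteq> j" "i \<noteq> k" "i \<noteq> l"
  shows "(\<integral>x. (G (c (x i)) \<bullet> c (x j)) * (G (c (x k)) \<bullet> c (x l)) \<partial>Pi\<^sub>M J (\<lambda>_. P)) = 0"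
proof -
  interpret S: product_sigma_finite "\<lambda>_ :: 'i. P"
    by standard
  let ?f = "\<lambda>x. (G (c (x i)) \<bullet> c (x j)) * (G (c (x k)) \<bullet> c (x l))"
  have J': "insert i (J - {i}) = J" using ijkl by blast
  have "(\<integral>x. ?f x \<partial>Pi\<^sub>M J (\<lambda>_. P)) = (\<integral>x. (\<integral>y. ?f (x(i := y)) \<partial>P) \<partial>Pi\<^sub>M (J - {i}) (\<lambda>_. P))"
    using S.product_integral_insert[of "J - {i}" i ?f] J kernel_product_integrable[OF ijkl]
    unfolding J' by simp
  also have "\<dots> = 0"
  proof (rule integral_eq_zero_AE, rule AE_I2)
    fix x
    have "(\<integral>y. ?f (x(i := y)) \<partial>P) = (\<integral>y. c y \<bullet> G (c (x j)) \<partial>P) * (G (c (x k)) \<bullet> c (x l))"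
      using i by (simp add: G_sa)
    also have "(\<integral>y. c y \<bullet> G (c (x j)) \<partial>P) = 0"
      using mean by (simp add: integrable_c)
    finally show "(\<integral>y. ?f (x(i := y)) \<partial>P) = 0" by simp
  qed
  finally show ?thesis .
qed

text \<open>With \<open>x j\<close> fixed, integrating out \<open>x i\<close> turns the squared
  kernel into the second moment form at \<open>G (c (x j))\<close>; what remains depends on one
  coordinate, whose law is \<open>P\<close>.\<close>

lemma kernel_variance:
  assumes ij: "i \<in> J" "j \<in> J" and ne: "i \<noteq> j"
  shows "(\<integral>x. (G (c (x i)) \<bullet> c (x j)) * (G (c (x i)) \<bullet> c (x j)) \<partial>Pi\<^sub>M J (\<lambda>_. P))
    = (\<integral>z. second_moment_op (G (c z)) \<bullet> G (c z) \<partial>P)"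
proof -
  interpret S: product_sigma_finite "\<lambda>_ :: 'i. P"
    by standard
  let ?f = "\<lambda>x. (G (c (x i)) \<bullet> c (x j)) * (G (c (x i)) \<bullet> c (x j))"
  let ?v = "\<lambda>z. second_moment_op (G (c z)) \<bullet> G (c z)"
  have J': "insert i (J - {i}) = J" using ij by blast
  have "(\<integral>x. ?f x \<partial>Pi\<^sub>M J (\<lambda>_. P)) = (\<integral>x. (\<integral>y. ?f (x(i := y)) \<partial>P) \<partial>Pi\<^sub>M (J - {i}) (\<lambda>_. P))"
    using S.product_integral_insert[of "J - {i}" i ?f] J kernel_product_integrable[OF ij ij]
    unfolding J' by simp
  also have "\<dots> = (\<integral>x. ?v (x j) \<partial>Pi\<^sub>M (J - {i}) (\<lambda>_. P))"
    using ne by (intro Bochner_Integration.integral_cong refl) (simp add: G_sa second_moment_op_inner)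
  also have "\<dots> = (\<integral>z. ?v z \<partial>distr (Pi\<^sub>M (J - {i}) (\<lambda>_. P)) P (\<lambda>x. x j))"
  proof (rule integral_distr[symmetric])
    show "(\<lambda>x. x j) \<in> measurable (Pi\<^sub>M (J - {i}) (\<lambda>_. P)) P"
      using ij ne by (intro measurable_component_singleton) auto
    have "continuous_on UNIV (\<lambda>u. second_moment_op (G u) \<bullet> G u)"
      using G second_moment_op_positive unfolding positive_op_def
      by (intro continuous_intros linear_continuous_on bounded_linear_compose[of second_moment_op G]) auto
    then show "?v \<in> borel_measurable P"
      using measurable_compose[OF c_measurable borel_measurable_continuous_onI] by blast
  qed
  also have "distr (Pi\<^sub>M (J - {i}) (\<lambda>_. P)) P (\<lambda>x. x j) = P"
    using ij ne by (intro distr_PiM_component prob_space_axioms) auto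
  finally show ?thesis .
qed

text \<open>Expand the square over two ordered pairs of indices. Given the first pair, only the same
  pair and its reversal contribute, each with the common variance.\<close>

lemma U_statistic_second_moment:
  defines "U \<equiv> \<lambda>x. \<Sum>i\<in>J. \<Sum>j\<in>J - {i}. G (c (x i)) \<bullet> c (x j)"
  shows "U \<in> borel_measurable (Pi\<^sub>M J (\<lambda>_. P))"
    and "integrable (Pi\<^sub>M J (\<lambda>_. P)) (\<lambda>x. (U x)\<^sup>2)"
    and "(\<integral>x. (U x)\<^sup>2 \<partial>Pi\<^sub>M J (\<lambda>_. P))
      = 2 * real (card J) * (real (card J) - 1) * (\<integral>z. second_moment_op (G (c z)) \<bullet> G (c z) \<partial>P)"
proof -
  let ?Q = "Pi\<^sub>M J (\<lambda>_. P)" and ?S = "Sigma J (\<lambda>i. J - {i})"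
  let ?V = "\<integral>z. second_moment_op (G (c z)) \<bullet> G (c z) \<partial>P"
  let ?h = "\<lambda>p x. G (c (x (fst p))) \<bullet> c (x (snd p))"
  have finS: "finite ?S" using J by auto
  have inJ: "fst p \<in> J" "snd p \<in> J" "fst p \<noteq> snd p" if "p \<in> ?S" for p using that by auto
  have U: "U x = (\<Sum>p\<in>?S. ?h p x)" for x
    unfolding U_def using J by (subst sum.Sigma) (auto simp: case_prod_unfold)
  have U2: "(U x)\<^sup>2 = (\<Sum>p\<in>?S. \<Sum>q\<in>?S. ?h p x * ?h q x)" for x
    by (simp add: U power2_eq_square sum_product)
  show "U \<in> borel_measurable ?Q"
    unfolding U_def by (intro borel_measurable_sum kernel_measurable) auto
  have int: "integrable ?Q (\<lambda>x. ?h p x * ?h q x)" if "p \<in> ?S" "q \<in> ?S" for p q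
    using inJ that by (intro kernel_product_integrable) auto
  show "integrable ?Q (\<lambda>x. (U x)\<^sup>2)"
    unfolding U2 by (intro Bochner_Integration.integrable_sum int)
  have sym: "G u \<bullet> v = G v \<bullet> u" for u v by (metis G_sa inner_commute)
  have "(\<integral>x. (U x)\<^sup>2 \<partial>?Q) = (\<Sum>p\<in>?S. \<Sum>q\<in>?S. \<integral>x. ?h p x * ?h q x \<partial>?Q)"
    unfolding U2 by (subst Bochner_Integration.integral_sum; (intro sum.cong refl Bochner_Integration.integral_sum)?)
      (auto intro!: Bochner_Integration.integrable_sum int simp del: mem_Sigma_iff)
  also have "\<dots> = (\<Sum>p\<in>?S. 2 * ?V)"
  proof (rule sum.cong[OF refl])
    fix p assume p: "p \<in> ?S"
    obtain i j where ij: "p = (i, j)" by (cases p)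
    have i: "i \<in> J" "j \<in> J" "i \<noteq> j" using inJ[OF p] ij by auto
    have "(\<Sum>q\<in>?S. \<integral>x. ?h p x * ?h q x \<partial>?Q) = (\<Sum>q\<in>{(i, j), (j, i)}. \<integral>x. ?h p x * ?h q x \<partial>?Q)"
    proof (rule sum.mono_neutral_right[OF finS])
      show "{(i, j), (j, i)} \<subseteq> ?S" using i by auto
      show "\<forall>q\<in>?S - {(i, j), (j, i)}. (\<integral>x. ?h p x * ?h q x \<partial>?Q) = 0"
      proof
        fix q assume q: "q \<in> ?S - {(i, j), (j, i)}"
        obtain k l where kl: "q = (k, l)" by (cases q)
        have k: "k \<in> J" "l \<in> J" "k \<noteq> l" using inJ[of q] q kl by auto
        \<comment> \<open>A pair of distinct indices containing both \<open>i\<close> and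
          \<open>j\<close> would be one of the two excluded ones, so \<open>i\<close> or
          \<open>j\<close> is absent and can be integrated out.\<close>
        have "(i \<noteq> k \<and> i \<noteq> l) \<or> (j \<noteq> k \<and> j \<noteq> l)" using q k i by (auto simp: kl)
        then show "(\<integral>x. ?h p x * ?h q x \<partial>?Q) = 0"
        proof
          assume "i \<noteq> k \<and> i \<noteq> l"
          then show ?thesis using kernel_uncorrelated[of i j k l] i k by (simp add: ij kl)
        next
          assume "j \<noteq> k \<and> j \<noteq> l"
          then show ?thesis using kernel_uncorrelated[of j i k l] i k
            by (simp add: ij kl sym[of "c (_ i)" "c (_ j)"])
        qed
      qed
    qed
    also have "\<dots> = 2 * ?V"
      using i kernel_variance[of i j] by (simp add: ij sym[of "c (_ j)" "c (_ i)"])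
    finally show "(\<Sum>q\<in>?S. \<integral>x. ?h p x * ?h q x \<partial>?Q) = 2 * ?V" .
  qed
  also have "\<dots> = real (card ?S) * (2 * ?V)" by simp
  also have "real (card ?S) = real (card J) * (real (card J) - 1)"
  proof -
    have "card ?S = (\<Sum>i\<in>J. card (J - {i}))" using J by (subst card_SigmaI) auto
    also have "\<dots> = card J * (card J - 1)" using J by (simp add: card_Diff_singleton)
    \<comment> \<open>The natural subtraction truncates for empty \<open>J\<close>, where the factor
      \<open>card J\<close> makes both sides zero.\<close>
    finally show ?thesis by (cases "card J") (auto simp: algebra_simps)
  qed
  finally show "(\<integral>x. (U x)\<^sup>2 \<partial>?Q) = 2 * real (card J) * (real (card J) - 1) * ?V" by simp
qed

end

end

section \<open>Kernel sections\<close>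

context rkhs
begin

lemma kernel_section_inner: "kernel_section evl K y \<bullet> kernel_section evl K x = K x y"
  using reproducing[of "kernel_section evl K y" x] f_inv_into_f[OF kernel_mem[of y]]
  by (simp add: kernel_section_def)

lemma norm_kernel_section: "(norm (kernel_section evl K x))\<^sup>2 = K x x"
  by (simp add: power2_norm_eq_inner kernel_section_inner)

end

text \<open>The squared distance of two sections is a combination of four kernel values, continuous
  in \<open>x\<close> and zero at \<open>x = a\<close>.\<close>

lemma kernel_section_continuous:
  fixes evl :: "'h::{real_inner, banach} \<Rightarrow> 'x::topological_space \<Rightarrow> real"
  assumes "rkhs evl K" and K: "continuous_on UNIV (\<lambda>(x, y). K x y)"
  shows "continuous_on UNIV (kernel_section evl K)"
  unfolding continuous_on_def
proof
  interpret rkhs evl K by fact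
  let ?k = "kernel_section evl K"
  fix a
  have contK: "continuous_on UNIV (\<lambda>x. K (u x) (v x))"
    if "continuous_on UNIV u" "continuous_on UNIV v" for u v :: "'x \<Rightarrow> 'x"
    using continuous_on_compose2[OF K continuous_on_Pair[OF that]] by simp
  have "continuous_on UNIV (\<lambda>x. sqrt (K x x - K a x - K x a + K a a))"
    by (intro continuous_intros contK)
  then have "((\<lambda>x. sqrt (K x x - K a x - K x a + K a a)) \<longlongrightarrow> sqrt (K a a - K a a - K a a + K a a)) (at a within UNIV)"
    unfolding continuous_on_def by blast
  moreover have "norm (?k x - ?k a) = sqrt (K x x - K a x - K x a + K a a)" for x
    by (simp add: norm_eq_sqrt_inner inner_diff_left inner_diff_right kernel_section_inner)
  ultimately have "((\<lambda>x. norm (?k x - ?k a)) \<longlongrightarrow> 0) (at a within UNIV)"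
    by simp
  then show "(?k \<longlongrightarrow> ?k a) (at a within UNIV)"
    by (simp add: tendsto_norm_zero_iff LIM_zero_iff)
qed

section \<open>The level of the test from a second moment bound\<close>

theorem theorem3:
  fixes evl :: "'h::{real_inner, banach, second_countable_topology} \<Rightarrow> 'x::second_countable_topology \<Rightarrow> real"
    and K :: "'x \<Rightarrow> 'x \<Rightarrow> real"
    and \<kappa> C1 C2 \<alpha> lam :: real
    and P0 :: "'x measure"
    and g :: "real \<Rightarrow> real \<Rightarrow> real"
    and M :: "'w measure"
    and X :: "nat \<Rightarrow> 'w \<Rightarrow> 'x"
    and n :: nat
  assumes "rkhs evl K"
    and "continuous_on UNIV (\<lambda>(x, y). K x y)"
    and "\<And>x. K x x \<le> \<kappa>"
    and "prob_space P0" and "sets P0 = sets borel"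
    and nondegenerate: "cov_op evl K P0 \<noteq> (\<lambda>f. 0)"
    and "\<And>l x. l > 0 \<Longrightarrow> x \<ge> 0 \<Longrightarrow> g l x > 0"
    and "C1 > 0" and "C2 > 0"
    and A1: "\<And>l x. l > 0 \<Longrightarrow> x \<in> {0..\<kappa>} \<Longrightarrow> \<bar>x * g l x\<bar> \<le> C1"
    and A2: "\<And>l x. l > 0 \<Longrightarrow> x \<in> {0..\<kappa>} \<Longrightarrow> \<bar>l * g l x\<bar> \<le> C2"
    and "n \<ge> 2"
    and "prob_space M"
    and "prob_space.indep_vars M (\<lambda>_. borel) X {1..n}"
    and "\<And>i. i \<in> {1..n} \<Longrightarrow> distr M borel (X i) = P0"
    and "\<alpha> > 0" and "lam > 0"
  shows "measure M {\<omega> \<in> space M. eta_hat evl K P0 (g lam) n (\<lambda>i. X i \<omega>)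
           \<ge> 2 * (C1 + C2) * N2 evl K P0 lam / (real n * sqrt \<alpha>)} \<le> \<alpha>"
proof -
  note lam = \<open>lam > 0\<close> and n2 = \<open>n \<ge> 2\<close> and \<alpha> = \<open>\<alpha> > 0\<close> and K_le = \<open>\<And>x. K x x \<le> \<kappa>\<close>
    and C12 = \<open>C1 > 0\<close> \<open>C2 > 0\<close> and sets_P0 = \<open>sets P0 = sets borel\<close>
    and indep = \<open>prob_space.indep_vars M (\<lambda>_. borel) X {1..n}\<close>
    and distr_X = \<open>\<And>i. i \<in> {1..n} \<Longrightarrow> distr M borel (X i) = P0\<close>
    and g_pos = \<open>\<And>l x. l > 0 \<Longrightarrow> x \<ge> 0 \<Longrightarrow> g l x > 0\<close>
  interpret rkhs evl K by fact
  interpret P0: prob_space P0 by fact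
  interpret M: prob_space M by fact
  let ?k = "kernel_section evl K" and ?c = "centered_section evl K P0" and ?G = "fun_calc (g lam) (cov_op evl K P0)"
  define A where "A = cov_op evl K P0"
  define \<mu> where "\<mu> = mean_element evl K P0"
  have \<kappa>: "0 \<le> \<kappa>" using norm_kernel_section[of undefined] K_le[of undefined] zero_le_power2 by (metis order_trans)
  have k_le: "norm (?k x) \<le> sqrt \<kappa>" for x
    using norm_kernel_section[of x] K_le[of x] by (intro real_le_rsqrt) simp
  have k_meas: "?k \<in> borel_measurable P0"
    using borel_measurable_continuous_onI[OF kernel_section_continuous[OF assms(1,2)]] sets_P0
    by (simp cong: measurable_cong_sets)
  have k_int: "integrable P0 ?k"
    using k_meas k_le by (intro P0.integrable_const_bound[where B = "sqrt \<kappa>"]) auto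
  have c_eq: "?c x = ?k x - \<mu>" for x by (simp add: centered_section_def \<mu>_def)
  have \<mu>_eq: "(\<integral>x. ?k x \<partial>P0) = \<mu>" by (simp add: \<mu>_def mean_element_def)
  interpret F: bounded_feature P0 ?c "sqrt \<kappa> + norm \<mu>"
  proof
    show "?c \<in> borel_measurable P0" unfolding c_eq using k_meas by simp
    show "norm (?c x) \<le> sqrt \<kappa> + norm \<mu>" for x
      unfolding c_eq using norm_triangle_ineq4[of "?k x" \<mu>] k_le[of x] by linarith
  qed
  have mean0: "(\<integral>x. ?c x \<partial>P0) = 0"
    unfolding c_eq using k_int by (simp add: \<mu>_eq P0.prob_space)
  have A: "A = F.second_moment_op"
    by (simp add: A_def cov_op_def F.second_moment_op_def fun_eq_iff)
  have A_pos: "positive_op A" and A_cpt: "compact_op A"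
    unfolding A by (rule F.second_moment_op_positive F.second_moment_op_compact)+
  have blA: "bounded_linear A" using A_pos by (simp add: positive_op_def)
  \<comment> \<open>The form at a unit vector is the variance of \<open>?k x \<bullet> f\<close>,
    hence at most its raw second moment. This places the spectrum in \<open>{0..\<kappa>}\<close>,
    where \<open>A1\<close> and \<open>A2\<close> apply; the cruder bound on the centered section
    would not.\<close>
  have A_le: "A f \<bullet> f \<le> \<kappa>" if f: "norm f = 1" for f
  proof -
    let ?Y = "\<lambda>x. ?k x \<bullet> f"
    have Y_le: "\<bar>?Y x\<bar> \<le> sqrt \<kappa>" for x
      using Cauchy_Schwarz_ineq2[of "?k x" f] k_le[of x] f by simp
    have Y2_le: "(?Y x)\<^sup>2 \<le> \<kappa>" for x
      using power_mono[OF Y_le[of x], of 2] \<kappa> by simp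
    have Y_int: "integrable P0 ?Y" using k_int by simp
    have Y2_int: "integrable P0 (\<lambda>x. (?Y x)\<^sup>2)"
      using Y2_le k_meas by (intro P0.integrable_const_bound[where B = \<kappa>]) auto
    have "A f \<bullet> f = (\<integral>x. (?Y x - (\<integral>x. ?Y x \<partial>P0))\<^sup>2 \<partial>P0)"
      unfolding A F.second_moment_op_quadratic c_eq using k_int by (simp add: \<mu>_eq inner_diff_left)
    also have "\<dots> = (\<integral>x. (?Y x)\<^sup>2 \<partial>P0) - (\<integral>x. ?Y x \<partial>P0)\<^sup>2"
      by (rule P0.variance_eq[OF Y_int Y2_int])
    also have "\<dots> \<le> (\<integral>x. (?Y x)\<^sup>2 \<partial>P0)" by simp
    also have "\<dots> \<le> (\<integral>x. \<kappa> \<partial>P0)" by (intro integral_mono Y2_int Y2_le) simp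
    finally show ?thesis by (simp add: P0.prob_space)
  qed
  have g_le: "\<bar>g lam x\<bar> \<le> C2 / lam" if "x \<in> {0..\<kappa>}" for x
    using A2[OF lam that] lam by (simp add: abs_mult field_simps)
  obtain E where E: "is_onb E" and eigA: "\<And>e. e \<in> E \<Longrightarrow> A e = (A e \<bullet> e) *\<^sub>R e"
    and blG: "bounded_linear ?G" and eigG: "\<And>e. e \<in> E \<Longrightarrow> ?G e = g lam (A e \<bullet> e) *\<^sub>R e"
    using fun_calc_eigenbasis[OF A_pos A_cpt \<kappa> A_le, of "g lam" "C2 / lam"] g_le
    unfolding A_def by auto
  define t where "t e = A e \<bullet> e" for e
  have At: "A e = t e *\<^sub>R e" if "e \<in> E" for e using eigA[OF that] by (simp only: t_def)
  have Gt: "?G e = g lam (t e) *\<^sub>R e" if "e \<in> E" for e using eigG[OF that] by (simp only: t_def)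
  have t0: "0 \<le> t e" for e unfolding t_def A by (simp add: F.second_moment_op_quadratic)
  have t\<kappa>: "t e \<in> {0..\<kappa>}" if "e \<in> E" for e
    using t0[of e] A_le[of e] E that by (simp add: t_def is_onb_def)
  have g0: "0 < g lam (t e)" for e by (rule g_pos[OF lam t0])

  have sum_t: "t summable_on E"
    using F.second_moment_op_trace[OF is_onb_orthonormal[OF E]] by (simp add: t_def[abs_def] A)
  define s where "s = (\<Sum>\<^sub>\<infinity>e\<in>E. (t e / (t e + lam))\<^sup>2)"
  have sum_s: "((\<lambda>e. (t e / (t e + lam))\<^sup>2) has_sum s) E"
    unfolding s_def
  proof (rule has_sum_infsum, rule summable_on_comparison_test)
    \<comment> \<open>The ratio lies in \<open>[0, 1]\<close>, so its square is at most itself and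
      then at most \<open>t e / lam\<close>; the finite trace dominates.\<close>
    show "(\<lambda>e. t e * (1 / lam)) summable_on E" using sum_t by (rule summable_on_cmult_left)
    fix e
    let ?r = "t e / (t e + lam)"
    have "0 \<le> ?r" "?r \<le> 1" using t0[of e] lam by (auto simp: divide_le_eq)
    then have "?r\<^sup>2 \<le> ?r" unfolding power2_eq_square by (intro mult_left_le)
    also have "?r \<le> t e / lam" using t0[of e] lam by (intro divide_left_mono) auto
    finally show "?r\<^sup>2 \<le> t e * (1 / lam)" by simp
  qed simp
  have N2: "N2 evl K P0 lam = sqrt s"
    unfolding N2_def Let_def A_def[symmetric]
    by (rule regularized_hs_norm[OF E blA lam At t0 sum_s refl])
  \<comment> \<open>A nonzero operator has a nonzero eigenvalue. For a zero covariance the statistic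
    would vanish almost surely and meet the zero threshold with probability one.\<close>
  have s_pos: "0 < s"
  proof -
    have "\<exists>e\<in>E. t e \<noteq> 0"
    proof (rule ccontr)
      assume "\<not> (\<exists>e\<in>E. t e \<noteq> 0)"
      then have "A e = 0" if "e \<in> E" for e using At[OF that] that by simp
      then have "A = (\<lambda>f. 0)" by (intro bounded_linear_eq_on_onb[OF E blA bounded_linear_zero])
      with nondegenerate show False by (simp add: A_def)
    qed
    then obtain e where e: "e \<in> E" "t e \<noteq> 0" by blast
    have "0 < (t e / (t e + lam))\<^sup>2" using e(2) t0[of e] lam by simp
    also have "\<dots> \<le> s" using finite_sum_le_has_sum[OF sum_s, of "{e}"] e(1) by simp
    finally show ?thesis .
  qed

  have G_sa: "?G f \<bullet> h = f \<bullet> ?G h" for f h by (rule diagonal_op_self_adjoint[OF E blG Gt])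
  define V where "V = (\<integral>z. F.second_moment_op (?G (?c z)) \<bullet> ?G (?c z) \<partial>P0)"
  have V_le: "V \<le> (C1 + C2)\<^sup>2 * s"
  proof -
    let ?w = "\<lambda>e. (g lam (t e))\<^sup>2 * t e"
    have w_le: "?w e * t e \<le> (C1 + C2)\<^sup>2 * (t e / (t e + lam))\<^sup>2" if e: "e \<in> E" for e
    proof -
      \<comment> \<open>The sum of the bounds \<open>A1\<close> and \<open>A2\<close> at the
        eigenvalue; this is where \<open>C1 + C2\<close> and the denominator of the effective
        dimension come from.\<close>
      have "g lam (t e) * (t e + lam) \<le> C1 + C2"
        using A1[OF lam t\<kappa>[OF e]] A2[OF lam t\<kappa>[OF e]] by (simp add: algebra_simps abs_le_iff)
      then have "g lam (t e) \<le> (C1 + C2) / (t e + lam)"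
        using t0[of e] lam by (simp add: pos_le_divide_eq)
      then have "g lam (t e) * t e \<le> (C1 + C2) / (t e + lam) * t e"
        by (rule mult_right_mono) (rule t0)
      then have "(g lam (t e) * t e)\<^sup>2 \<le> ((C1 + C2) / (t e + lam) * t e)\<^sup>2"
        using g0[of e] t0[of e] by (intro power_mono) auto
      then show ?thesis by (simp add: power2_eq_square mult_ac)
    qed
    have sum_C: "((\<lambda>e. (C1 + C2)\<^sup>2 * (t e / (t e + lam))\<^sup>2) has_sum (C1 + C2)\<^sup>2 * s) E"
      by (rule has_sum_cmult_right[OF sum_s])
    have sum_w: "(\<lambda>e. ?w e * t e) summable_on E"
      by (rule summable_on_comparison_test[OF has_sum_imp_summable[OF sum_C] w_le]) (auto simp: t0)
    \<comment> \<open>Self-adjointness moves the outer \<open>?G\<close> across. The resulting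
      operator has eigenvalues \<open>?w e\<close>, and pairing them with the second moments
      \<open>t e\<close> gives \<open>(g lam (t e) * t e)\<^sup>2\<close>.\<close>
    have "V = (\<integral>z. (?G \<circ> A \<circ> ?G) (?c z) \<bullet> ?c z \<partial>P0)"
      unfolding V_def by (simp add: A G_sa)
    also have "\<dots> \<le> (\<Sum>\<^sub>\<infinity>e\<in>E. ?w e * t e)"
    proof (rule F.expectation_quadratic_form_le[OF E])
      show "bounded_linear (?G \<circ> A \<circ> ?G)"
        using bounded_linear_compose[OF blG bounded_linear_compose[OF blA blG]] by (simp add: o_def)
      show "(?G \<circ> A \<circ> ?G) e = ?w e *\<^sub>R e" if "e \<in> E" for e
        using that by (simp add: Gt At linear_simps[OF blG] linear_simps[OF blA] power2_eq_square mult_ac)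
      show "0 \<le> ?w e" for e by (simp add: t0)
      show "((\<lambda>e. ?w e * (F.second_moment_op e \<bullet> e)) has_sum (\<Sum>\<^sub>\<infinity>e\<in>E. ?w e * t e)) E"
        using sum_w by (simp add: t_def A)
    qed
    also have "\<dots> \<le> (C1 + C2)\<^sup>2 * s"
      by (rule has_sum_mono[OF has_sum_infsum[OF sum_w] sum_C w_le])
    finally show ?thesis .
  qed

  let ?T = "op_sqrt ?G" and ?J = "{1..n}"
  have "positive_op ?T" "?T \<circ> ?T = ?G"
    using diagonal_op_sqrt(1,2)[OF E blG Gt] g0 by (auto simp: less_imp_le)
  \<comment> \<open>Moving one factor \<open>?T\<close> across the inner product removes the square
    root from the statistic.\<close>
  then have T: "?T u \<bullet> ?T v = ?G u \<bullet> v" for u v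
    unfolding positive_op_def by (metis comp_apply)
  define U where "U x = (\<Sum>i\<in>?J. \<Sum>j\<in>?J - {i}. ?G (?c (x i)) \<bullet> ?c (x j))" for x
  define N where "N = real n * (real n - 1)"
  have N: "N > 0" using n2 by (simp add: N_def)
  have eta: "eta_hat evl K P0 (g lam) n x = U x / N" for x
    unfolding eta_hat_def Let_def T U_def N_def by simp
  let ?Q = "Pi\<^sub>M ?J (\<lambda>_. P0)" and ?X = "\<lambda>\<omega>. \<lambda>i\<in>?J. X i \<omega>"
  note U_facts = F.U_statistic_second_moment[OF blG G_sa mean0, of ?J, OF finite_atLeastAtMost, folded U_def, folded V_def]
  have X_meas: "X i \<in> borel_measurable M" if "i \<in> ?J" for i
    using indep that by (auto simp: M.indep_vars_def)
  have sets_Q: "sets ?Q = sets (Pi\<^sub>M ?J (\<lambda>_. borel))"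
    by (intro sets_PiM_cong refl) (simp add: sets_P0)
  have "?X \<in> measurable M (Pi\<^sub>M ?J (\<lambda>_. borel))"
    using X_meas by (intro measurable_restrict)
  then have X_Q: "?X \<in> measurable M ?Q"
    by (simp only: measurable_cong_sets[OF refl sets_Q])
  have "distr M (Pi\<^sub>M ?J (\<lambda>_. borel)) ?X = Pi\<^sub>M ?J (\<lambda>i. distr M borel (X i))"
    using M.indep_vars_iff_distr_eq_PiM'[of ?J X "\<lambda>_. borel"] X_meas indep n2 by auto
  also have "\<dots> = ?Q" by (intro PiM_cong refl distr_X)
  finally have "distr M (Pi\<^sub>M ?J (\<lambda>_. borel)) ?X = ?Q" .
  \<comment> \<open>By independence the sample vector has the product law. The two product
    sigma-algebras have the same sets, so \<open>P0\<close> may replace the Borel algebra as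
    codomain.\<close>
  then have distr_Q: "distr M ?Q ?X = ?Q"
    using distr_cong[OF refl sets_Q, of M ?X ?X] by (simp only:)
  \<comment> \<open>Points of the product space are undefined outside \<open>?J\<close>, but
    \<open>U\<close> reads only coordinates in \<open>?J\<close>.\<close>
  have U_X: "U (?X \<omega>) = U (\<lambda>i. X i \<omega>)" for \<omega>
    unfolding U_def by (intro sum.cong refl) auto
  let ?u = "\<lambda>\<omega>. U (\<lambda>i. X i \<omega>)"
  have u_int: "integrable M (\<lambda>\<omega>. (?u \<omega>)\<^sup>2)"
    using integrable_distr[OF X_Q, of "\<lambda>x. (U x)\<^sup>2"] U_facts(2) unfolding distr_Q U_X by (simp only:)
  have "(\<integral>\<omega>. (?u \<omega>)\<^sup>2 \<partial>M) = (\<integral>x. (U x)\<^sup>2 \<partial>distr M ?Q ?X)"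
    using integral_distr[OF X_Q borel_measurable_power[OF U_facts(1)], of 2] by (simp only: U_X)
  then have u_mom: "(\<integral>\<omega>. (?u \<omega>)\<^sup>2 \<partial>M) = 2 * N * V"
    unfolding distr_Q using U_facts(3) by (simp add: N_def)

  define \<gamma> where "\<gamma> = 2 * (C1 + C2) * sqrt s / (real n * sqrt \<alpha>)"
  have \<gamma>: "\<gamma> > 0" unfolding \<gamma>_def using C12 s_pos n2 \<alpha> by simp
  \<comment> \<open>Since \<gamma> and \<open>N\<close> are positive, squaring preserves the
    inequality, and Markov's inequality can be applied to the square.\<close>
  have "measure M {\<omega> \<in> space M. \<gamma> \<le> ?u \<omega> / N} \<le> measure M {\<omega> \<in> space M. (\<gamma> * N)\<^sup>2 \<le> (?u \<omega>)\<^sup>2}"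
  proof (rule M.finite_measure_mono)
    show "{\<omega> \<in> space M. \<gamma> \<le> ?u \<omega> / N} \<subseteq> {\<omega> \<in> space M. (\<gamma> * N)\<^sup>2 \<le> (?u \<omega>)\<^sup>2}"
    proof safe
      fix \<omega> assume "\<gamma> \<le> ?u \<omega> / N"
      then have "\<gamma> * N \<le> ?u \<omega>" using N by (simp add: pos_le_divide_eq)
      then show "(\<gamma> * N)\<^sup>2 \<le> (?u \<omega>)\<^sup>2" using \<gamma> N by (intro power_mono) auto
    qed
    have [measurable]: "(\<lambda>\<omega>. (?u \<omega>)\<^sup>2) \<in> borel_measurable M" using u_int by (rule borel_measurable_integrable)
    show "{\<omega> \<in> space M. (\<gamma> * N)\<^sup>2 \<le> (?u \<omega>)\<^sup>2} \<in> sets M" by measurable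
  qed
  also have "\<dots> \<le> (\<integral>\<omega>. (?u \<omega>)\<^sup>2 \<partial>M) / (\<gamma> * N)\<^sup>2"
    using u_int \<gamma> N by (intro integral_Markov_inequality_measure[where A = "space M"]) auto
  also have "\<dots> \<le> 2 * N * ((C1 + C2)\<^sup>2 * s) / (\<gamma> * N)\<^sup>2"
    unfolding u_mom using V_le N by (intro divide_right_mono mult_left_mono) auto
  also have "\<dots> = \<alpha> * (real n / (2 * (real n - 1)))"
  proof -
    \<comment> \<open>Here \<open>m\<close>, \<open>D\<close> and \<open>a\<close> stand for the
      sample size, \<open>(C1 + C2)\<^sup>2\<close> and the level; both \<open>D\<close> and
      \<open>s\<close> cancel.\<close>
    have alg: "2 * (m * (m - 1)) * (D * s) / (4 * D * s / (m\<^sup>2 * a) * (m * (m - 1))\<^sup>2)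
        = a * (m / (2 * (m - 1)))"
      if "D \<noteq> 0" "s \<noteq> 0" "m \<noteq> 0" "m - 1 \<noteq> 0" "a \<noteq> 0" for D s m a :: real
      using that by (simp add: power2_eq_square divide_simps)
    have "(\<gamma> * N)\<^sup>2 = 4 * (C1 + C2)\<^sup>2 * s / ((real n)\<^sup>2 * \<alpha>) * N\<^sup>2"
      using s_pos \<alpha>
      by (simp add: \<gamma>_def power_mult_distrib power_divide del: distrib_left_numeral)
    then show ?thesis
      unfolding N_def using C12 s_pos n2 \<alpha>
        alg[of "(C1 + C2)\<^sup>2" s "real n" \<alpha>] by simp
  qed
  \<comment> \<open>The remaining factor is at most one exactly because \<open>n \<ge> 2\<close>,
    with equality at \<open>n = 2\<close>.\<close>
  also have "\<dots> \<le> \<alpha> * 1"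
    using n2 \<alpha> by (intro mult_left_mono) (auto simp: divide_le_eq)
  finally show ?thesis
    unfolding eta N2 \<gamma>_def by simp
qed

end
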